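(* Let $X$ be a finite state space, $U$ a finite action set, $p=\{p(x,y,u)\}$ the transition probabilities of a unichain controlled Markov chain, and $r,c:X\times U\to[0,1]$ reward and cost functions. Assume the CMDP $\max_{\pi}\bar r(\pi)$ subject to $\bar c(\pi)\le c_{ub}$ is strictly feasible. Let $\pi^\star$ be an optimal stationary randomized policy for this CMDP, and let $r^\star=\bar r(\pi^\star)$ be its optimal value. Let $\Pi_F$ be the finite set of policies obtained from a finite tessellation of the simplex $\Delta(U)$ with mesh $\epsilon>0$, and let $\hat\pi\in\Pi_F$ be the policy closest to $\pi^\star$, i.e. for each $x\in X$, $\hat\pi(x)$ is a point of the tessellation closest to $\pi^\star(x)$. Then $$\bar r(\hat\pi)\ \ge\ r^\star-\epsilon\,\kappa_p|X|^2\qquad\text{and}\qquad \bar c(\hat\pi)\ \le\ c_{ub}+\epsilon\,\kappa_p|X|^2 .$$ Furthermore, the discretization error $$r^\star-\max_{\pi\in\Pi_F:\ \bar c(\pi)\le c_{ub}}\bar r(\pi)$$ is $O(\epsilon)$ (as the mesh $\epsilon\to0$, with the CMDP fixed).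
   Context: A controlled Markov chain has finite state space $X$, finite action set $U$ and transition probabilities $\mathbb P(x(t+1)=y\mid x(t)=x,u(t)=u)=p(x,y,u)$. $\Delta(U)$ is the set of probability distributions on $U$. A stationary randomized policy $\pi$ maps each $x\in X$ to $\pi(x)\in\Delta(U)$; at each time the action $u(t)$ is sampled from $\pi(x(t))$. Average reward and cost: $\bar r(\pi)=\liminf_{T\to\infty}\frac1T\sum_{t=1}^T\mathbb E_\pi r(x(t),u(t))$ and $\bar c(\pi)=\limsup_{T\to\infty}\frac1T\sum_{t=1}^T\mathbb E_\pi c(x(t),u(t))$. The CMDP is $\max_\pi\bar r(\pi)$ subject to $\bar c(\pi)\le c_{ub}$, over stationary randomized policies. Unichain: for a stationary policy $\pi$, $\tau^\pi_{x,y}$ is the time taken to hit $y$ when started in $x$ (for $y=x$, the return time). The MDP is unichain if $\mathbb E[\tau^\pi_{x,y}]<\infty$ for all $x,y\in X$ and all stationary $\pi$. Conductivity: $\kappa_p:=\max_{\pi}\max_{x\in X}\dfrac{\max_{y\ne x}\mathbb E[\tau^\pi_{x,y}]}{2\,\mathbb E[\tau^\pi_{x,x}]}$, the outer maximum being over stationary randomized policies (here $|X|\ge2$). Strictly feasible: there exist a stationary policy $\pi_{feas.}$ and a constant $\epsilon_0>0$ with $\bar c(\pi_{feas.})<c_{ub}-\epsilon_0$. Tessellation of mesh $\epsilon$: a finite set $D\subset\Delta(U)$ such that every point of $\Delta(U)$ is within $\ell_1$-distance $\epsilon$ of some point of $D$; "closest" is with respect to $\ell_1$-distance. $\Pi_F$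 is the set of stationary policies $\pi$ with $\pi(x)\in D$ for all $x\in X$. *)

theory Defs
  imports "HOL-Probability.Probability"
begin

text \<open>
  The finite state space and action set are the finite types \<open>'x\<close> and \<open>'u\<close>, so \<open>\<Delta>(U)\<close> is
  \<open>'u pmf\<close>. The transition probability \<open>p(x,y,u)\<close> is \<open>pmf (p x u) y\<close>.
\<close>

type_synonym ('x, 'u) kernel = "'x \<Rightarrow> 'u \<Rightarrow> 'x pmf"
type_synonym ('x, 'u) policy = "'x \<Rightarrow> 'u pmf"

definition with_action :: "('x, 'u) policy \<Rightarrow> 'x pmf \<Rightarrow> ('x \<times> 'u) pmf" where
  "with_action \<pi> \<nu> = bind_pmf \<nu> (\<lambda>x. map_pmf (Pair x) (\<pi> x))"

definition step ::
  "('x, 'u) kernel \<Rightarrow> ('x, 'u) policy \<Rightarrow> 'x pmf \<Rightarrow> nat \<Rightarrow> (nat \<Rightarrow> 'x \<times> 'u) \<Rightarrow> ('x \<times> 'u) pmf" where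
  "step p \<pi> \<mu> t \<omega> =
     with_action \<pi> (case t of 0 \<Rightarrow> \<mu> | Suc s \<Rightarrow> p (fst (\<omega> s)) (snd (\<omega> s)))"

text \<open>
  The law of the state-action process \<open>(x(t), u(t))\<close>, \<open>t = 0, 1, 2, \<dots>\<close>, with \<open>x(0)\<close> distributed
  as \<open>\<mu>\<close>: the measure on sequences that the Ionescu-Tulcea theorem builds from \<open>step\<close>.
\<close>

definition trajectory ::
  "('x::finite, 'u::finite) kernel \<Rightarrow> ('x, 'u) policy \<Rightarrow> 'x pmf \<Rightarrow> (nat \<Rightarrow> 'x \<times> 'u) measure" where
  "trajectory p \<pi> \<mu> =
     projective_family.lim UNIV
       (Ionescu_Tulcea.CI (\<lambda>t \<omega>. measure_pmf (step p \<pi> \<mu> t \<omega>)) (\<lambda>_. count_space UNIV))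
       (\<lambda>_. count_space UNIV)"

lemma Ionescu_Tulcea_step:
  fixes p :: "('x::finite, 'u::finite) kernel"
  shows "Ionescu_Tulcea (\<lambda>t \<omega>. measure_pmf (step p \<pi> \<mu> t \<omega>)) (\<lambda>_. count_space UNIV)"
proof
  fix t
  show "(\<lambda>\<omega>. measure_pmf (step p \<pi> \<mu> t \<omega>))
      \<in> measurable (PiM {0..<t} (\<lambda>_. count_space UNIV)) (subprob_algebra (count_space UNIV))"
  proof (cases t)
    case 0
    then show ?thesis
      by (simp add: step_def measure_pmf_in_subprob_algebra)
  next
    case (Suc s)
    have "(\<lambda>\<omega>. \<omega> s) \<in> measurable (PiM {0..<t} (\<lambda>_. count_space UNIV)) (count_space UNIV)"
      using Suc by (intro measurable_component_singleton) auto
    moreover have "(\<lambda>z. measure_pmf (with_action \<pi> (p (fst z) (snd z))))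
        \<in> measurable (count_space UNIV) (subprob_algebra (count_space UNIV))"
      by (simp add: measure_pmf_in_subprob_algebra)
    ultimately show ?thesis
      unfolding step_def Suc by (auto dest: measurable_compose)
  qed
qed

lemma pmf_with_action: "pmf (with_action \<pi> \<nu>) (x, u) = pmf \<nu> x * pmf (\<pi> x) u"
proof -
  have "pmf (map_pmf (Pair y) (\<pi> y)) (x, u) = indicator {x} y * pmf (\<pi> x) u" for y
  proof (cases "y = x")
    case True
    then show ?thesis
      using pmf_map_inj'[of "Pair x" "\<pi> x" u] by (simp add: inj_on_def)
  next
    case False
    then show ?thesis
      by (auto simp: pmf_eq_0_set_pmf)
  qed
  then have "pmf (with_action \<pi> \<nu>) (x, u) = (\<integral>y. indicator {x} y * pmf (\<pi> x) u \<partial>measure_pmf \<nu>)"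
    by (simp add: with_action_def pmf_bind)
  then show ?thesis
    by (simp add: measure_pmf_single)
qed

text \<open>
  The next three facts identify \<open>trajectory\<close>: it is the probability measure on the product
  \<open>\<sigma>\<close>-algebra under which each finite path has the product of its step probabilities.
\<close>

lemma trajectory_cylinder:
  "emeasure (trajectory p \<pi> \<mu>) {\<omega>. \<forall>t<n. \<omega> t = s t} =
     ennreal (\<Prod>t<n. pmf (step p \<pi> \<mu> t s) (s t))"
proof -
  interpret Ionescu_Tulcea "\<lambda>t \<omega>. measure_pmf (step p \<pi> \<mu> t \<omega>)" "\<lambda>_. count_space UNIV"
    by (rule Ionescu_Tulcea_step)
  let ?M = "\<lambda>_::nat. count_space (UNIV :: ('a \<times> 'b) set)"
  let ?r = "\<lambda>n. restrict s {0..<n}"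
  have sets: "{?r k} \<in> sets (PiM {0..<k} ?M)" for k
  proof -
    have "{?r k} = PiE {0..<k} (\<lambda>t. {s t})"
      by (auto simp: PiE_iff extensional_def fun_eq_iff)
    then show ?thesis
      by (auto intro!: sets_PiM_I_finite)
  qed
  have C: "emeasure (C 0 k (\<lambda>_. undefined)) {?r k} =
      ennreal (\<Prod>t<k. pmf (step p \<pi> \<mu> t s) (s t))" for k
  proof (induction k)
    case 0
    then show ?case
      by (simp add: PiM_empty)
  next
    case (Suc k)
    let ?q = "ennreal (pmf (step p \<pi> \<mu> k s) (s k))"
    have u: "(\<lambda>_. undefined) \<in> space (PiM {0..<0} ?M)"
      by (simp add: space_PiM)
    have "emeasure (eP k \<omega>) {?r (Suc k)} = ?q * indicator {?r k} \<omega>"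
      if "\<omega> \<in> space (PiM {0..<k} ?M)" for \<omega>
    proof (cases "\<omega> = ?r k")
      case True
      have "fun_upd \<omega> k -` {?r (Suc k)} = {s k}"
      proof -
        have "fun_upd \<omega> k x = ?r (Suc k) \<longleftrightarrow> x = s k" for x
          unfolding True by (auto simp: restrict_def dest: fun_cong[of _ _ k])
        then show ?thesis
          by auto
      qed
      moreover have "step p \<pi> \<mu> k \<omega> = step p \<pi> \<mu> k s"
        unfolding True by (auto simp: step_def split: nat.split)
      ultimately show ?thesis
        unfolding emeasure_eP[OF that sets] by (simp add: emeasure_pmf_single) (simp add: True)
    next
      case False
      have "fun_upd \<omega> k -` {?r (Suc k)} = {}"
      proof -
        have "\<omega> = ?r k" if eq: "fun_upd \<omega> k x = ?r (Suc k)" for x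
        proof
          fix i
          show "\<omega> i = ?r k i"
            using fun_cong[OF eq, of i] \<open>\<omega> \<in> space (PiM {0..<k} ?M)\<close>
            by (cases "i < k") (auto simp: space_PiM PiE_iff extensional_def)
        qed
        with False show ?thesis
          by auto
      qed
      with False show ?thesis
        unfolding emeasure_eP[OF that sets] by simp
    qed
    then have "emeasure (C 0 (Suc k) (\<lambda>_. undefined)) {?r (Suc k)} =
        (\<integral>\<^sup>+\<omega>. ?q * indicator {?r k} \<omega> \<partial>C 0 k (\<lambda>_. undefined))"
      using prob_space_C[OF u, THEN prob_space.not_empty, of k]
      by (subst C.simps, subst emeasure_bind[OF _ _ sets])
         (auto simp: space_C[OF u] measurable_cong_sets[OF sets_C[OF u] refl]
            intro!: nn_integral_cong)
    also have "\<dots> = ?q * emeasure (C 0 k (\<lambda>_. undefined)) {?r k}"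
      using sets[of k] by (intro nn_integral_cmult_indicator) (simp add: sets_C[OF u])
    also have "\<dots> = ennreal (\<Prod>t<Suc k. pmf (step p \<pi> \<mu> t s) (s t))"
      by (simp add: Suc.IH ennreal_mult[symmetric] prod_nonneg mult.commute)
    finally show ?case .
  qed
  have "restrict \<omega> {0..<n} = ?r n \<longleftrightarrow> (\<forall>t<n. \<omega> t = s t)" for \<omega>
    by (auto simp: restrict_def fun_eq_iff)
  then have "{\<omega>. \<forall>t<n. \<omega> t = s t} = prod_emb UNIV ?M {0..<n} {?r n}"
    by (auto simp: prod_emb_def space_PiM)
  then have "emeasure (trajectory p \<pi> \<mu>) {\<omega>. \<forall>t<n. \<omega> t = s t} = emeasure (CI {0..<n}) {?r n}"
    unfolding trajectory_def using lim[OF _ sets[of n]] by simp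
  also have "\<dots> = emeasure (C 0 n (\<lambda>_. undefined)) {?r n}"
    using emeasure_CI[OF order_refl sets[of n]]
    by (simp add: prod_emb_id[OF sets.sets_into_space[OF sets[of n], unfolded space_PiM]])
  finally show ?thesis
    by (simp add: C)
qed

lemma sets_trajectory: "sets (trajectory p \<pi> \<mu>) = sets (PiM UNIV (\<lambda>_. count_space UNIV))"
proof -
  interpret Ionescu_Tulcea "\<lambda>t \<omega>. measure_pmf (step p \<pi> \<mu> t \<omega>)" "\<lambda>_. count_space UNIV"
    by (rule Ionescu_Tulcea_step)
  show ?thesis
    unfolding trajectory_def by simp
qed

lemma prob_space_trajectory: "prob_space (trajectory p \<pi> \<mu>)"
proof
  have "space (trajectory p \<pi> \<mu>) = UNIV"
    using sets_eq_imp_space_eq[OF sets_trajectory] by (simp add: space_PiM)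
  then show "emeasure (trajectory p \<pi> \<mu>) (space (trajectory p \<pi> \<mu>)) = 1"
    using trajectory_cylinder[of p \<pi> \<mu> 0] by simp
qed

definition expect_at ::
  "('x::finite, 'u::finite) kernel \<Rightarrow> 'x pmf \<Rightarrow> ('x, 'u) policy \<Rightarrow> ('x \<Rightarrow> 'u \<Rightarrow> real) \<Rightarrow> nat \<Rightarrow> real"
  where
  "expect_at p \<mu> \<pi> f t = (\<integral>\<omega>. f (fst (\<omega> t)) (snd (\<omega> t)) \<partial>trajectory p \<pi> \<mu>)"

text \<open>
  Since \<open>f\<close> is a function on a finite set, the averages are bounded, so the extended-real
  liminf and limsup are finite and \<open>real_of_ereal\<close> loses nothing.
\<close>

definition avg_reward ::
  "('x::finite, 'u::finite) kernel \<Rightarrow> 'x pmf \<Rightarrow> ('x \<Rightarrow> 'u \<Rightarrow> real) \<Rightarrow> ('x, 'u) policy \<Rightarrow> real" where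
  "avg_reward p \<mu> f \<pi> =
     real_of_ereal (liminf (\<lambda>T. ereal (1 / real T * (\<Sum>t=1..T. expect_at p \<mu> \<pi> f t))))"

definition avg_cost ::
  "('x::finite, 'u::finite) kernel \<Rightarrow> 'x pmf \<Rightarrow> ('x \<Rightarrow> 'u \<Rightarrow> real) \<Rightarrow> ('x, 'u) policy \<Rightarrow> real" where
  "avg_cost p \<mu> f \<pi> =
     real_of_ereal (limsup (\<lambda>T. ereal (1 / real T * (\<Sum>t=1..T. expect_at p \<mu> \<pi> f t))))"

text \<open>Time \<open>0\<close> does not count, so for the initial state this is the return time.\<close>

definition hitting_time :: "'x \<Rightarrow> (nat \<Rightarrow> 'x \<times> 'u) \<Rightarrow> enat" where
  "hitting_time y \<omega> = Inf {enat t | t. 1 \<le> t \<and> fst (\<omega> t) = y}"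

definition expected_hit ::
  "('x::finite, 'u::finite) kernel \<Rightarrow> ('x, 'u) policy \<Rightarrow> 'x \<Rightarrow> 'x \<Rightarrow> ennreal" where
  "expected_hit p \<pi> x y =
     (\<integral>\<^sup>+\<omega>. ennreal_of_enat (hitting_time y \<omega>) \<partial>trajectory p \<pi> (return_pmf x))"

definition unichain :: "('x::finite, 'u::finite) kernel \<Rightarrow> bool" where
  "unichain p \<longleftrightarrow> (\<forall>\<pi> x y. expected_hit p \<pi> x y < \<infinity>)"

text \<open>
  The maximum over the infinite set of policies is a supremum in \<open>ennreal\<close>. For a unichain \<open>p\<close>
  it is finite and attained, by compactness of the policy space. The other two maxima range over
  finite sets, nonempty if there are at least two states.
\<close>

definition conductivity :: "('x::finite, 'u::finite) kernel \<Rightarrow> real" where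
  "conductivity p = enn2real
     (SUP \<pi>. MAX x. (MAX y\<in>-{x}. expected_hit p \<pi> x y) / (2 * expected_hit p \<pi> x x))"

definition strictly_feasible ::
  "('x::finite, 'u::finite) kernel \<Rightarrow> 'x pmf \<Rightarrow> ('x \<Rightarrow> 'u \<Rightarrow> real) \<Rightarrow> real \<Rightarrow> bool" where
  "strictly_feasible p \<mu> c cub \<longleftrightarrow> (\<exists>\<pi> \<epsilon>\<^sub>0. 0 < \<epsilon>\<^sub>0 \<and> avg_cost p \<mu> c \<pi> < cub - \<epsilon>\<^sub>0)"

definition optimal_policy ::
  "('x::finite, 'u::finite) kernel \<Rightarrow> 'x pmf \<Rightarrow> ('x \<Rightarrow> 'u \<Rightarrow> real) \<Rightarrow> ('x \<Rightarrow> 'u \<Rightarrow> real) \<Rightarrow> real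
     \<Rightarrow> ('x, 'u) policy \<Rightarrow> bool" where
  "optimal_policy p \<mu> r c cub \<pi> \<longleftrightarrow>
     avg_cost p \<mu> c \<pi> \<le> cub \<and>
     (\<forall>\<pi>'. avg_cost p \<mu> c \<pi>' \<le> cub \<longrightarrow> avg_reward p \<mu> r \<pi>' \<le> avg_reward p \<mu> r \<pi>)"

definition l1_dist :: "'u::finite pmf \<Rightarrow> 'u pmf \<Rightarrow> real" where
  "l1_dist a b = (\<Sum>u\<in>UNIV. \<bar>pmf a u - pmf b u\<bar>)"

definition tessellation :: "real \<Rightarrow> 'u::finite pmf set \<Rightarrow> bool" where
  "tessellation \<epsilon> D \<longleftrightarrow> finite D \<and> (\<forall>q. \<exists>d\<in>D. l1_dist q d \<le> \<epsilon>)"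

definition grid_policies :: "'u pmf set \<Rightarrow> ('x, 'u) policy set" where
  "grid_policies D = {\<pi>. \<forall>x. \<pi> x \<in> D}"

definition closest_policy ::
  "'u::finite pmf set \<Rightarrow> ('x, 'u) policy \<Rightarrow> ('x, 'u) policy \<Rightarrow> bool" where
  "closest_policy D \<pi> \<pi>' \<longleftrightarrow>
     \<pi>' \<in> grid_policies D \<and> (\<forall>x. \<forall>d\<in>D. l1_dist (\<pi> x) (\<pi>' x) \<le> l1_dist (\<pi> x) d)"

definition feasible_grid ::
  "('x::finite, 'u::finite) kernel \<Rightarrow> 'x pmf \<Rightarrow> ('x \<Rightarrow> 'u \<Rightarrow> real) \<Rightarrow> real \<Rightarrow> 'u pmf set
     \<Rightarrow> ('x, 'u) policy set" where
  "feasible_grid p \<mu> c cub D = {\<pi> \<in> grid_policies D. avg_cost p \<mu> c \<pi> \<le> cub}"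

end

theory Submission
  imports Defs
begin

text \<open>
  Under a unichain kernel every stationary policy \<open>\<pi>\<close> makes the states an irreducible chain whose
  mean hitting times \<open>m(x,y)\<close> are finite, and all that is needed about long-run averages can be read
  off from these. The stationary distribution is \<open>\<rho>(y) = 1 / m(y,y)\<close>. Write \<open>P\<close> for
  the transition matrix under \<open>\<pi>\<close> and \<open>m\<^sub>0\<close> for \<open>m\<close> with zero diagonal. The function \<open>h(x) = - (\<Sum>y. \<rho>(y) f(y) m\<^sub>0(x,y))\<close> solves the Poisson equation
  \<open>h - P h = f - g\<close> with \<open>g = \<Sum>y. \<rho>(y) f(y)\<close> (\<open>poisson_equation\<close>). Telescoping shows that the time
  averages converge to \<open>g\<close> from every initial law (\<open>cesaro_average\<close>), so the liminf and the limsup in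
  the definitions are both the limit \<open>g\<close>.

  The first claim is a perturbation bound for \<open>g\<close>. For two policies \<open>\<pi>\<close> and \<open>\<pi>'\<close> the Poisson equation of
  \<open>\<pi>\<close>, averaged over the stationary distribution of \<open>\<pi>'\<close>, expresses the difference of the two averages
  by \<open>(\<pi>' - \<pi>)(y)(u) * (f(y,u) + (\<Sum>z. p(y,z,u) h(z)))\<close> (\<open>performance_difference\<close>). As
  \<open>\<pi>' - \<pi>\<close> sums to zero, only the oscillation of the second factor counts, and only half of
  the distance of the policies. For \<open>0 \<le> f \<le> 1\<close> the function \<open>h\<close> lies between \<open>-K\<close> and \<open>0\<close>,
  where \<open>K = \<Sum>y. \<rho>(y) m\<^sub>0(x,y)\<close> is the Kemeny constant, which is the same for all \<open>x\<close>
  (\<open>random_target\<close>) because it is harmonic in \<open>x\<close>. Averaging \<open>K\<close> over \<open>x\<close> turns it into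
  a sum of terms \<open>\<rho>(y) (m(x,y) / m(x,x))\<close>, and this ratio is at most \<open>2\<kappa>\<close>
  for the conductivity \<open>\<kappa>\<close>. Hence
  \<open>K \<le> 2\<kappa>(n-1)\<close> for \<open>n\<close> states. Likewise \<open>1 \<le> 2\<kappa>n\<close>, since some state returns
  within mean time \<open>n\<close>. The total is \<open>\<epsilon>\<kappa>(2n-1)\<close>, which is at most \<open>\<epsilon>\<kappa>n\<^sup>2\<close>.

  For these estimates \<open>\<kappa>\<close> has to bound the ratios, so the supremum defining it must be
  finite. Each mean hitting time is maximized by one of the finitely many deterministic policies
  (\<open>deterministic_policy_maximizes_mean_hit\<close>), by policy improvement.

  For the second claim the optimal policy may sit on the boundary of the feasible set, so rounding it can
  violate the constraint. Convex combinations of state-action frequencies are again those of a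
  stationary policy (\<open>mixed_policy\<close>). Mixing in the strictly feasible policy with a weight of order \<open>\<epsilon>\<close>
  gains enough slack in the cost to absorb the rounding error and loses only \<open>O(\<epsilon>)\<close> of reward.
\<close>

section \<open>Taboo probabilities of a finite chain\<close>

text \<open>
  \<open>killed_law P Y \<nu> k\<close> is the sub-distribution of the state at time \<open>k\<close>, restricted to the paths that
  avoid \<open>Y\<close> at times \<open>1, \<dots>, k\<close>, and \<open>survival P Y k x\<close> is the probability of these paths from
  \<open>x\<close>. Time \<open>0\<close> is exempt, as it is for return times.
\<close>

primrec killed_law ::
  "('x::finite \<Rightarrow> 'x \<Rightarrow> real) \<Rightarrow> 'x set \<Rightarrow> ('x \<Rightarrow> real) \<Rightarrow> nat \<Rightarrow> 'x \<Rightarrow> real" where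
  "killed_law P Y \<nu> 0 = \<nu>"
| "killed_law P Y \<nu> (Suc k) =
     (\<lambda>z. if z \<in> Y then 0 else \<Sum>w\<in>UNIV. killed_law P Y \<nu> k w * P w z)"

primrec survival :: "('x::finite \<Rightarrow> 'x \<Rightarrow> real) \<Rightarrow> 'x set \<Rightarrow> nat \<Rightarrow> 'x \<Rightarrow> real" where
  "survival P Y 0 = (\<lambda>_. 1)"
| "survival P Y (Suc k) = (\<lambda>x. \<Sum>z\<in>-Y. P x z * survival P Y k z)"

lemma sum_if_not_in:
  fixes f :: "'x::finite \<Rightarrow> real"
  shows "(\<Sum>z\<in>UNIV. if z \<in> Y then 0 else f z) = (\<Sum>z\<in>-Y. f z)"
  by (simp add: sum.If_cases Compl_eq)

lemma killed_law_Suc_pairing: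
  "(\<Sum>z\<in>UNIV. killed_law P Y \<nu> (Suc k) z * f z) =
     (\<Sum>w\<in>UNIV. killed_law P Y \<nu> k w * (\<Sum>z\<in>-Y. P w z * f z))"
proof -
  have "(\<Sum>z\<in>UNIV. killed_law P Y \<nu> (Suc k) z * f z) =
      (\<Sum>z\<in>UNIV. if z \<in> Y then 0 else \<Sum>w\<in>UNIV. killed_law P Y \<nu> k w * P w z * f z)"
    by (intro sum.cong) (auto simp: sum_distrib_right)
  also have "\<dots> = (\<Sum>z\<in>-Y. \<Sum>w\<in>UNIV. killed_law P Y \<nu> k w * P w z * f z)"
    by (rule sum_if_not_in)
  also have "\<dots> = (\<Sum>w\<in>UNIV. \<Sum>z\<in>-Y. killed_law P Y \<nu> k w * P w z * f z)"
    by (rule sum.swap)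
  finally show ?thesis
    by (simp add: sum_distrib_left mult.assoc)
qed

text \<open>
  The forward and the backward recursion are adjoint to each other, so the pairing of the law after
  \<open>k\<close> steps with the survival probability for \<open>j\<close> more steps depends only on \<open>k + j\<close>.
\<close>

lemma sum_killed_law:
  "(\<Sum>z\<in>UNIV. killed_law P Y \<nu> k z) = (\<Sum>x\<in>UNIV. \<nu> x * survival P Y k x)"
proof -
  have "(\<Sum>z\<in>UNIV. killed_law P Y \<nu> k z * survival P Y j z) =
      (\<Sum>x\<in>UNIV. \<nu> x * survival P Y (k + j) x)" for j
  proof (induction k arbitrary: j)
    case (Suc k)
    show ?case
      using Suc.IH[of "Suc j"] by (simp only: killed_law_Suc_pairing survival.simps add_Suc_shift)
  qed simp
  from this[of 0] show ?thesis
    by simp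
qed

lemma abs_sum_mult_le_half_l1:
  fixes a b :: "'a::finite \<Rightarrow> real"
  assumes "(\<Sum>i\<in>UNIV. a i) = 0" and "\<And>i. l \<le> b i" and "\<And>i. b i \<le> l + s"
  shows "\<bar>\<Sum>i\<in>UNIV. a i * b i\<bar> \<le> s / 2 * (\<Sum>i\<in>UNIV. \<bar>a i\<bar>)"
proof -
  (* As the weights sum to 0, b may be centred at the midpoint of its range. *)
  have "(\<Sum>i\<in>UNIV. a i * b i) = (\<Sum>i\<in>UNIV. a i * (b i - (l + s / 2)))"
    using assms(1) by (simp add: right_diff_distrib sum_subtractf flip: sum_distrib_right)
  also have "\<bar>\<dots>\<bar> \<le> (\<Sum>i\<in>UNIV. \<bar>a i\<bar> * (s / 2))"
  proof (rule order_trans[OF sum_abs], rule sum_mono)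
    fix i
    have "\<bar>b i - (l + s / 2)\<bar> \<le> s / 2"
      using assms(2,3)[of i] by (simp add: abs_le_iff field_simps)
    then show "\<bar>a i * (b i - (l + s / 2))\<bar> \<le> \<bar>a i\<bar> * (s / 2)"
      by (simp only: abs_mult mult_left_mono abs_ge_zero)
  qed
  finally show ?thesis
    unfolding sum_distrib_right[symmetric] by (simp only: mult.commute)
qed

section \<open>Chains with finite mean hitting times\<close>

locale hitting_chain =
  fixes P :: "'x::finite \<Rightarrow> 'x \<Rightarrow> real"
  assumes nonneg: "0 \<le> P x z"
    and row_sum: "(\<Sum>z\<in>UNIV. P x z) = 1"
    and summable_survival: "summable (\<lambda>k. survival P {y} k x)"
begin

text \<open>
  The mean of a random time is the sum of its tail probabilities. For \<open>x = y\<close> this is the mean return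
  time, whereas \<open>mean_reach\<close> below is \<open>0\<close> on the diagonal.
\<close>

definition mean_hit :: "'x \<Rightarrow> 'x \<Rightarrow> real" where
  "mean_hit x y = (\<Sum>k. survival P {y} k x)"

definition mean_reach :: "'x \<Rightarrow> 'x \<Rightarrow> real" where
  "mean_reach x y = (if x = y then 0 else mean_hit x y)"

lemma survival_nonneg: "0 \<le> survival P Y k x"
  by (induction k arbitrary: x) (auto intro!: sum_nonneg mult_nonneg_nonneg nonneg)

lemma mean_hit_ge_1: "1 \<le> mean_hit x y"
  using sum_le_suminf[OF summable_survival[of y x], of "{0}"] survival_nonneg
  by (simp add: mean_hit_def)

lemma mean_reach_nonneg: "0 \<le> mean_reach x y"
  using mean_hit_ge_1[of x y] by (simp add: mean_reach_def)

lemma mean_hit_killed_first_step: "mean_hit x y = 1 + (\<Sum>z\<in>-{y}. P x z * mean_hit z y)"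
proof -
  have "(\<lambda>k. survival P {y} (Suc k) x) sums (\<Sum>z\<in>-{y}. P x z * mean_hit z y)"
    unfolding survival.simps mean_hit_def
    by (intro sums_sum sums_mult summable_sums summable_survival)
  then have "(\<Sum>k. survival P {y} (Suc k) x) = (\<Sum>z\<in>-{y}. P x z * mean_hit z y)"
    by (rule sums_unique[symmetric])
  then show ?thesis
    using suminf_split_head[OF summable_survival[of y x]] by (simp add: mean_hit_def)
qed

lemma mean_hit_first_step: "mean_hit x y = 1 + (\<Sum>z\<in>UNIV. P x z * mean_reach z y)"
proof -
  have "(\<Sum>z\<in>UNIV. P x z * mean_reach z y) = (\<Sum>z\<in>-{y}. P x z * mean_hit z y)"
    unfolding mean_reach_def by (subst sum_if_not_in[symmetric]) (auto intro: sum.cong)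
  then show ?thesis
    by (subst mean_hit_killed_first_step) simp
qed

text \<open>
  Iterating the hypothesis \<open>k\<close> times bounds \<open>g\<close> below by a constant times the probability of avoiding
  \<open>y\<close> for \<open>k\<close> steps, which vanishes as \<open>k\<close> grows.
\<close>

lemma minimum_principle:
  assumes super: "\<And>x. (\<Sum>z\<in>-{y}. P x z * g z) \<le> g x"
  shows "0 \<le> g x"
proof -
  define C where "C = (\<Sum>z\<in>UNIV. \<bar>g z\<bar>)"
  have "- C * survival P {y} k x \<le> g x" for k x
  proof (induction k arbitrary: x)
    case 0
    have "\<bar>g x\<bar> \<le> C"
      unfolding C_def by (rule member_le_sum) auto
    then show ?case
      by simp
  next
    case (Suc k)
    have "- C * survival P {y} (Suc k) x = (\<Sum>z\<in>-{y}. P x z * (- C * survival P {y} k z))"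
      by (simp add: sum_distrib_left mult_ac flip: sum_negf)
    also have "\<dots> \<le> (\<Sum>z\<in>-{y}. P x z * g z)"
      by (intro sum_mono mult_left_mono Suc nonneg)
    finally show ?case
      using super[of x] by simp
  qed
  moreover have "(\<lambda>k. - C * survival P {y} k x) \<longlonglongrightarrow> - C * 0"
    by (intro tendsto_mult_left summable_LIMSEQ_zero summable_survival)
  ultimately show ?thesis
    by (auto intro: LIMSEQ_le_const2)
qed

text \<open>
  The minimum principle applies to the difference of the two sides, as the mean hitting times solve the
  first-step equation. Together with the next lemma this is the tool for policy improvement.
\<close>

lemma mean_hit_le_supersolution:
  assumes "\<And>x. 1 + (\<Sum>z\<in>-{y}. P x z * \<phi> z) \<le> \<phi> x"
  shows "mean_hit x y \<le> \<phi> x"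
proof -
  have "0 \<le> \<phi> x - mean_hit x y"
  proof (rule minimum_principle[where y = y and g = "\<lambda>x. \<phi> x - mean_hit x y"])
    fix x
    show "(\<Sum>z\<in>-{y}. P x z * (\<phi> z - mean_hit z y)) \<le> \<phi> x - mean_hit x y"
      using assms[of x] mean_hit_killed_first_step[of x y]
      by (simp add: right_diff_distrib sum_subtractf)
  qed
  then show ?thesis
    by simp
qed

lemma mean_hit_ge_subsolution:
  assumes "\<And>x. \<phi> x \<le> 1 + (\<Sum>z\<in>-{y}. P x z * \<phi> z)"
  shows "\<phi> x \<le> mean_hit x y"
proof -
  have "0 \<le> mean_hit x y - \<phi> x"
  proof (rule minimum_principle[where y = y and g = "\<lambda>x. mean_hit x y - \<phi> x"])
    fix x
    show "(\<Sum>z\<in>-{y}. P x z * (mean_hit z y - \<phi> z)) \<le> mean_hit x y - \<phi> x"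
      using assms[of x] mean_hit_killed_first_step[of x y]
      by (simp add: right_diff_distrib sum_subtractf)
  qed
  then show ?thesis
    by simp
qed

definition stationary :: "('x \<Rightarrow> real) \<Rightarrow> bool" where
  "stationary \<rho> \<longleftrightarrow>
     (\<forall>x. 0 \<le> \<rho> x) \<and> (\<Sum>x\<in>UNIV. \<rho> x) = 1 \<and> (\<forall>z. (\<Sum>w\<in>UNIV. \<rho> w * P w z) = \<rho> z)"

lemma stationary_pairing:
  assumes "stationary \<rho>"
  shows "(\<Sum>w\<in>UNIV. \<rho> w * (\<Sum>z\<in>UNIV. P w z * f z)) = (\<Sum>z\<in>UNIV. \<rho> z * f z)"
proof -
  have "(\<Sum>w\<in>UNIV. \<rho> w * (\<Sum>z\<in>UNIV. P w z * f z)) =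
      (\<Sum>w\<in>UNIV. \<Sum>z\<in>UNIV. \<rho> w * P w z * f z)"
    by (simp add: sum_distrib_left mult.assoc)
  also have "\<dots> = (\<Sum>z\<in>UNIV. \<Sum>w\<in>UNIV. \<rho> w * P w z * f z)"
    by (rule sum.swap)
  also have "\<dots> = (\<Sum>z\<in>UNIV. \<rho> z * f z)"
    using assms by (simp add: stationary_def flip: sum_distrib_right)
  finally show ?thesis .
qed

text \<open>
  Averaging the first-step equation over \<open>\<rho>\<close> makes all terms cancel except the diagonal one. This
  gives Kac's formula and, with it, uniqueness of the stationary distribution.
\<close>

lemma stationary_mean_return:
  assumes "stationary \<rho>"
  shows "\<rho> y * mean_hit y y = 1"
proof -
  have "(\<Sum>x\<in>UNIV. \<rho> x * mean_hit x y) =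
      (\<Sum>x\<in>UNIV. \<rho> x) + (\<Sum>x\<in>UNIV. \<rho> x * (\<Sum>z\<in>UNIV. P x z * mean_reach z y))"
    by (subst mean_hit_first_step) (simp add: distrib_left sum.distrib)
  also have "\<dots> = 1 + (\<Sum>x\<in>UNIV. \<rho> x * mean_reach x y)"
    using assms by (simp add: stationary_pairing) (simp add: stationary_def)
  also have "(\<Sum>x\<in>UNIV. \<rho> x * mean_reach x y) = (\<Sum>x\<in>UNIV. \<rho> x * mean_hit x y) - \<rho> y * mean_hit y y"
    unfolding mean_reach_def
    by (subst (2) sum.remove[of _ y]) (auto simp: if_distrib sum.remove[of _ y] intro!: sum.cong)
  finally show ?thesis
    by simp
qed

lemma stationary_pos: "stationary \<rho> \<Longrightarrow> 0 < \<rho> y"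
  using stationary_mean_return[of \<rho> y] by (fastforce simp: stationary_def less_le)

text \<open>
  The expected numbers of visits during an excursion from a state \<open>a\<close> back to \<open>a\<close> form an invariant
  vector, and its total mass is the mean return time to \<open>a\<close>.
\<close>

lemma stationary_exists: "\<exists>\<rho>. stationary \<rho>"
proof -
  fix a :: 'x
  define R where "R k = killed_law P {a} (indicator {a}) k" for k
  have sum_R: "(\<Sum>z\<in>UNIV. R k z) = survival P {a} k a" for k
    by (simp add: R_def sum_killed_law sum.remove[of _ a] indicator_def)
  have R_nonneg: "0 \<le> R k z" for k z
    unfolding R_def by (induction k arbitrary: z) (auto intro!: sum_nonneg mult_nonneg_nonneg nonneg)
  have summable_R: "summable (\<lambda>k. R k z)" for z
  proof (rule summable_comparison_test'[OF summable_survival[of a a], of 0])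
    fix k
    show "norm (R k z) \<le> survival P {a} k a"
      using member_le_sum[of z UNIV "R k"] R_nonneg by (simp flip: sum_R)
  qed
  define N where "N z = (\<Sum>k. R k z)" for z
  have N_nonneg: "0 \<le> N z" for z
    unfolding N_def by (intro suminf_nonneg summable_R R_nonneg)
  have sum_N: "(\<Sum>z\<in>UNIV. N z) = mean_hit a a"
    unfolding N_def mean_hit_def by (subst suminf_sum[symmetric]) (auto simp: summable_R sum_R)
  have step_N: "(\<Sum>w\<in>UNIV. N w * P w z) = (\<Sum>k. \<Sum>w\<in>UNIV. R k w * P w z)" for z
    unfolding N_def
    by (subst suminf_sum) (auto intro!: summable_mult2 summable_R sum.cong suminf_mult2)
  have inv: "(\<Sum>w\<in>UNIV. N w * P w z) = N z" if "z \<noteq> a" for z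
  proof -
    have "(\<Sum>w\<in>UNIV. N w * P w z) = (\<Sum>k. R (Suc k) z)"
      using that by (simp add: step_N R_def)
    also have "\<dots> = N z"
      using suminf_split_head[OF summable_R[of z]] that by (simp add: N_def R_def)
    finally show ?thesis .
  qed
  have "(\<Sum>z\<in>UNIV. \<Sum>w\<in>UNIV. N w * P w z) = (\<Sum>w\<in>UNIV. \<Sum>z\<in>UNIV. N w * P w z)"
    by (rule sum.swap)
  also have "\<dots> = (\<Sum>z\<in>UNIV. N z)"
    by (simp add: row_sum flip: sum_distrib_left)
  (* Total mass is preserved, so balance at all other states forces balance at a. *)
  finally have "(\<Sum>w\<in>UNIV. N w * P w a) = N a"
    using inv by (simp add: sum.remove[of _ a])
  with inv have inv: "(\<Sum>w\<in>UNIV. N w * P w z) = N z" for z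
    by (cases "z = a") auto
  have "stationary (\<lambda>z. N z / mean_hit a a)"
    unfolding stationary_def using mean_hit_ge_1[of a a] N_nonneg
    by (auto simp: sum_N inv simp flip: sum_divide_distrib)
  then show ?thesis
    by blast
qed

definition stat :: "'x \<Rightarrow> real" where
  "stat y = 1 / mean_hit y y"

lemma stationary_unique:
  assumes "stationary \<rho>"
  shows "\<rho> = stat"
proof
  fix y
  show "\<rho> y = stat y"
    using stationary_mean_return[OF assms, of y] mean_hit_ge_1[of y y] by (simp add: stat_def field_simps)
qed

lemma stationary_stat: "stationary stat"
  using stationary_exists stationary_unique by blast

lemma stat_pos: "0 < stat x"
  and stat_nonneg: "0 \<le> stat x"
  and sum_stat: "(\<Sum>x\<in>UNIV. stat x) = 1"
  using stationary_stat stationary_pos[OF stationary_stat, of x] by (auto simp: stationary_def)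

text \<open>
  This is, up to an additive constant, the bias (relative value) function of average-reward
  dynamic programming, written with hitting times in place of the deviation matrix.
\<close>

definition bias :: "('x \<Rightarrow> real) \<Rightarrow> 'x \<Rightarrow> real" where
  "bias f x = - (\<Sum>y\<in>UNIV. stat y * f y * mean_reach x y)"

text \<open>
  On average one step lowers the mean time to reach \<open>y\<close> by exactly \<open>1\<close>, except at \<open>y\<close> itself, where
  the return time \<open>mean_hit y y\<close> comes on top, and this is the reciprocal of \<open>stat y\<close>.
\<close>

lemma poisson_equation:
  "bias f x - (\<Sum>z\<in>UNIV. P x z * bias f z) = f x - (\<Sum>y\<in>UNIV. stat y * f y)"
proof -
  have "(\<Sum>z\<in>UNIV. P x z * bias f z) =
      - (\<Sum>z\<in>UNIV. \<Sum>y\<in>UNIV. stat y * f y * (P x z * mean_reach z y))"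
    by (simp add: bias_def sum_distrib_left mult_ac flip: sum_negf)
  also have "\<dots> = - (\<Sum>y\<in>UNIV. stat y * f y * (\<Sum>z\<in>UNIV. P x z * mean_reach z y))"
    by (subst sum.swap) (simp add: sum_distrib_left)
  also have "\<dots> = - (\<Sum>y\<in>UNIV. stat y * f y * (mean_hit x y - 1))"
    by (simp add: mean_hit_first_step)
  also have "\<dots> = (\<Sum>y\<in>UNIV. stat y * f y) - (\<Sum>y\<in>UNIV. stat y * f y * mean_hit x y)"
    by (simp add: right_diff_distrib sum_subtractf)
  also have "(\<Sum>y\<in>UNIV. stat y * f y * mean_hit x y) =
      f x + (\<Sum>y\<in>UNIV. stat y * f y * mean_reach x y)"
  proof -
    have "(\<Sum>y\<in>UNIV. stat y * f y * mean_hit x y) - (\<Sum>y\<in>UNIV. stat y * f y * mean_reach x y) =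
        (\<Sum>y\<in>UNIV. if y = x then stat x * f x * mean_hit x x else 0)"
      unfolding sum_subtractf[symmetric] by (intro sum.cong) (auto simp: mean_reach_def)
    also have "\<dots> = f x"
      using stationary_mean_return[OF stationary_stat, of x] by (simp add: mult_ac)
    finally show ?thesis
      by simp
  qed
  finally show ?thesis
    by (simp add: bias_def)
qed

lemma sum_killed_law_empty:
  assumes "(\<Sum>x\<in>UNIV. \<nu> x) = 1"
  shows "(\<Sum>z\<in>UNIV. killed_law P {} \<nu> t z) = 1"
  using assms
proof (induction t)
  case (Suc t)
  then show ?case
    using killed_law_Suc_pairing[of P "{}" \<nu> t "\<lambda>_. 1"] by (simp add: row_sum)
qed simp

text \<open>
  By the Poisson equation the deviation of each term from the limit is an increment of the expected
  bias, so the sum telescopes and stays bounded.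
\<close>

lemma cesaro_average:
  assumes "\<And>x. 0 \<le> \<nu> x" and "(\<Sum>x\<in>UNIV. \<nu> x) = 1"
  shows "(\<lambda>T. 1 / real T * (\<Sum>t=1..T. \<Sum>z\<in>UNIV. killed_law P {} \<nu> t z * f z))
           \<longlonglongrightarrow> (\<Sum>y\<in>UNIV. stat y * f y)"
proof -
  define g where "g = (\<Sum>y\<in>UNIV. stat y * f y)"
  define E where "E t h = (\<Sum>z\<in>UNIV. killed_law P {} \<nu> t z * h z)" for t h
  define C where "C = (\<Sum>z\<in>UNIV. \<bar>bias f z\<bar>)"
  have law: "(\<Sum>z\<in>UNIV. killed_law P {} \<nu> t z) = 1" for t
    using assms(2) by (rule sum_killed_law_empty)
  have law_nonneg: "0 \<le> killed_law P {} \<nu> t z" for t z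
    using assms(1) by (induction t arbitrary: z) (auto intro!: sum_nonneg mult_nonneg_nonneg nonneg)
  have E_f: "E t f = g + (E t (bias f) - E (Suc t) (bias f))" for t
  proof -
    have "E t f = E t (\<lambda>z. g + (bias f z - (\<Sum>w\<in>UNIV. P z w * bias f w)))"
      by (simp add: poisson_equation g_def)
    also have "\<dots> = g * (\<Sum>z\<in>UNIV. killed_law P {} \<nu> t z) +
        (E t (bias f) - (\<Sum>z\<in>UNIV. killed_law P {} \<nu> t z * (\<Sum>w\<in>UNIV. P z w * bias f w)))"
      unfolding E_def
      by (simp add: distrib_left right_diff_distrib sum.distrib sum_subtractf sum_distrib_left mult.commute)
    also have "(\<Sum>z\<in>UNIV. killed_law P {} \<nu> t z * (\<Sum>w\<in>UNIV. P z w * bias f w)) = E (Suc t) (bias f)"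
      unfolding E_def using killed_law_Suc_pairing[of P "{}" \<nu> t "bias f"] by simp
    finally show ?thesis
      by (simp add: law)
  qed
  have sum_E: "(\<Sum>t=1..T. E t f) = real T * g + (E 1 (bias f) - E (Suc T) (bias f))" for T
    by (induction T) (auto simp: E_f algebra_simps)
  have E_bound: "\<bar>E t (bias f)\<bar> \<le> C" for t
  proof -
    have "\<bar>E t (bias f)\<bar> \<le> (\<Sum>z\<in>UNIV. killed_law P {} \<nu> t z * C)"
      unfolding E_def
    proof (rule order_trans[OF sum_abs], rule sum_mono)
      fix z
      have "\<bar>bias f z\<bar> \<le> C"
        unfolding C_def by (rule member_le_sum) auto
      then show "\<bar>killed_law P {} \<nu> t z * bias f z\<bar> \<le> killed_law P {} \<nu> t z * C"
        using law_nonneg[of t z] by (simp add: abs_mult mult_left_mono)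
    qed
    then show ?thesis
      by (simp add: law flip: sum_distrib_right)
  qed
  have "(\<lambda>T. 1 / real T * (\<Sum>t=1..T. E t f) - g) \<longlonglongrightarrow> 0"
  proof (rule tendsto_rabs_zero_cancel, rule tendsto_sandwich[where f = "\<lambda>_. 0"])
    show "\<forall>\<^sub>F T in sequentially. \<bar>1 / real T * (\<Sum>t=1..T. E t f) - g\<bar> \<le> 2 * C / real T"
    proof (rule eventually_sequentiallyI[of 1])
      fix T :: nat
      assume "1 \<le> T"
      then have "1 / real T * (\<Sum>t=1..T. E t f) - g = (E 1 (bias f) - E (Suc T) (bias f)) / real T"
        unfolding sum_E by (simp add: field_simps)
      moreover have "\<bar>E 1 (bias f) - E (Suc T) (bias f)\<bar> \<le> 2 * C"
        using E_bound[of 1] E_bound[of "Suc T"] by linarith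
      ultimately show "\<bar>1 / real T * (\<Sum>t=1..T. E t f) - g\<bar> \<le> 2 * C / real T"
        by (simp add: divide_right_mono)
    qed
    show "(\<lambda>T. 2 * C / real T) \<longlonglongrightarrow> 0"
      by (rule lim_const_over_n)
  qed auto
  then show ?thesis
    unfolding E_def g_def by (rule LIM_zero_cancel)
qed

text \<open>
  Started at \<open>x\<close>, a harmonic function has expectation \<open>f x\<close> at all times, but its time averages converge
  to a limit that does not depend on \<open>x\<close>.
\<close>

lemma harmonic_constant:
  assumes harmonic: "\<And>x. (\<Sum>z\<in>UNIV. P x z * f z) = f x"
  shows "f x = (\<Sum>y\<in>UNIV. stat y * f y)"
proof -
  define \<nu> :: "'x \<Rightarrow> real" where "\<nu> = indicator {x}"
  have "(\<Sum>z\<in>UNIV. killed_law P {} \<nu> t z * f z) = f x" for t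
  proof (induction t)
    case 0
    show ?case
      by (simp add: \<nu>_def indicator_def sum.remove[of _ x])
  next
    case (Suc t)
    then show ?case
      using killed_law_Suc_pairing[of P "{}" \<nu> t f] by (simp add: harmonic)
  qed
  then have "(\<lambda>T. 1 / real T * (real T * f x)) \<longlonglongrightarrow> (\<Sum>y\<in>UNIV. stat y * f y)"
    using cesaro_average[of \<nu> f] by (simp add: \<nu>_def indicator_def sum.remove[of _ x])
  moreover have "\<forall>\<^sub>F T in sequentially. 1 / real T * (real T * f x) = f x"
    by (rule eventually_sequentiallyI[of 1]) simp
  ultimately have "(\<lambda>_::nat. f x) \<longlonglongrightarrow> (\<Sum>y\<in>UNIV. stat y * f y)"
    by (rule Lim_transform_eventually)
  then show ?thesis
    by (simp add: LIMSEQ_const_iff)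
qed

definition kemeny :: real where
  "kemeny = (\<Sum>x\<in>UNIV. stat x * (\<Sum>y\<in>UNIV. stat y * mean_reach x y))"

text \<open>
  Kemeny's constant: the mean time to reach a state drawn from the stationary distribution does not
  depend on the starting point. It is the negative bias of the constant function \<open>1\<close>, and is harmonic by
  the Poisson equation.
\<close>

lemma random_target: "(\<Sum>y\<in>UNIV. stat y * mean_reach x y) = kemeny"
  unfolding kemeny_def
proof (rule harmonic_constant)
  fix x
  have "bias (\<lambda>_. 1) x - (\<Sum>z\<in>UNIV. P x z * bias (\<lambda>_. 1) z) = 0"
    by (simp add: poisson_equation sum_stat)
  then show "(\<Sum>z\<in>UNIV. P x z * (\<Sum>y\<in>UNIV. stat y * mean_reach z y)) =
      (\<Sum>y\<in>UNIV. stat y * mean_reach x y)"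
    by (simp add: bias_def sum_negf)
qed

text \<open>
  As Kemeny's constant averages over start and target alike, Kac's formula for the start \<open>x\<close> can be
  used: \<open>stat x * mean_hit x y\<close> is the ratio that the hypothesis bounds. It has the return time of the
  start, not of the target, in the denominator.
\<close>

lemma kemeny_le:
  assumes "\<And>x y. x \<noteq> y \<Longrightarrow> mean_hit x y \<le> 2 * \<kappa> * mean_hit x x"
  shows "kemeny \<le> 2 * \<kappa> * (real CARD('x) - 1)"
proof -
  have mass: "stat x * mean_reach x y \<le> (if y = x then 0 else 2 * \<kappa>)" for x y
  proof (cases "y = x")
    case False
    have "stat x * mean_hit x y \<le> stat x * (2 * \<kappa> * mean_hit x x)"
      using False assms[of x y] stat_nonneg[of x] by (intro mult_left_mono) auto
    also have "\<dots> = 2 * \<kappa> * (stat x * mean_hit x x)"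
      by simp
    finally show ?thesis
      using False stationary_mean_return[OF stationary_stat, of x] by (simp add: mean_reach_def)
  qed (simp add: mean_reach_def)
  have "kemeny = (\<Sum>x\<in>UNIV. \<Sum>y\<in>UNIV. stat y * (stat x * mean_reach x y))"
    unfolding kemeny_def by (simp add: sum_distrib_left mult_ac)
  also have "\<dots> \<le> (\<Sum>x\<in>UNIV. \<Sum>y\<in>UNIV. stat y * (if y = x then 0 else 2 * \<kappa>))"
    by (intro sum_mono mult_left_mono mass stat_nonneg)
  also have "\<dots> = (\<Sum>y\<in>UNIV. \<Sum>x\<in>UNIV. stat y * (if y = x then 0 else 2 * \<kappa>))"
    by (rule sum.swap)
  also have "\<dots> = (\<Sum>y\<in>UNIV. stat y * (2 * \<kappa> * (real CARD('x) - 1)))"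
  proof (rule sum.cong[OF refl])
    fix y :: 'x
    have "(\<Sum>x\<in>UNIV. if y = x then 0 else 2 * \<kappa>) = (\<Sum>x\<in>-{y}. 2 * \<kappa>)"
      using sum_if_not_in[of "{y}" "\<lambda>_. 2 * \<kappa>"] by (simp add: eq_commute)
    also have "\<dots> = 2 * \<kappa> * (real CARD('x) - 1)"
      by (simp add: Compl_eq_Diff_UNIV card_Diff_singleton of_nat_diff Suc_le_eq)
    finally show "(\<Sum>x\<in>UNIV. stat y * (if y = x then 0 else 2 * \<kappa>)) =
        stat y * (2 * \<kappa> * (real CARD('x) - 1))"
      by (simp flip: sum_distrib_left)
  qed
  also have "\<dots> = 2 * \<kappa> * (real CARD('x) - 1)"
    by (simp add: sum_stat flip: sum_distrib_right)
  finally show ?thesis .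
qed

lemma bias_bounds:
  assumes "\<And>x. 0 \<le> f x" and "\<And>x. f x \<le> 1"
  shows "- kemeny \<le> bias f x" and "bias f x \<le> 0"
proof -
  have "(\<Sum>y\<in>UNIV. stat y * f y * mean_reach x y) \<le> (\<Sum>y\<in>UNIV. stat y * mean_reach x y)"
    using assms by (intro sum_mono mult_right_mono mult_left_le mean_reach_nonneg stat_nonneg)
  then show "- kemeny \<le> bias f x"
    by (simp add: bias_def random_target)
  show "bias f x \<le> 0"
    unfolding bias_def using assms by (simp add: sum_nonneg stat_nonneg mean_reach_nonneg)
qed

text \<open>
  Some state carries at least the average stationary mass, hence has mean return time at most the
  number of states. Reaching any other state from it takes at least one step.
\<close>

lemma one_le_conductivity:
  assumes "2 \<le> CARD('x)"
    and "\<And>x y. x \<noteq> y \<Longrightarrow> mean_hit x y \<le> 2 * \<kappa> * mean_hit x x"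
  shows "1 \<le> 2 * \<kappa> * real CARD('x)"
proof -
  have "\<exists>x. 1 / real CARD('x) \<le> stat x"
  proof (rule ccontr)
    assume "\<nexists>x. 1 / real CARD('x) \<le> stat x"
    then have "(\<Sum>x\<in>(UNIV::'x set). stat x) < (\<Sum>x\<in>(UNIV::'x set). 1 / real CARD('x))"
      by (intro sum_strict_mono) (auto simp: not_le)
    then show False
      by (simp add: sum_stat)
  qed
  then obtain x where x: "1 / real CARD('x) \<le> stat x" ..
  then have return: "mean_hit x x \<le> real CARD('x)"
    using mean_hit_ge_1[of x x] by (simp add: stat_def field_simps)
  have "UNIV \<noteq> {x}"
    using assms(1) by (metis card_1_singleton_iff Suc_1 not_less_eq_eq order_refl One_nat_def)
  then obtain y where "x \<noteq> y"
    by (metis UNIV_eq_I singletonI)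
  then have le: "1 \<le> 2 * \<kappa> * mean_hit x x"
    using assms(2)[of x y] mean_hit_ge_1[of x y] by linarith
  have "0 < 2 * \<kappa> * mean_hit x x" "0 < mean_hit x x"
    using le mean_hit_ge_1[of x x] by linarith+
  then have "0 < 2 * \<kappa>"
    by (rule zero_less_mult_pos2)
  then show ?thesis
    using le mult_left_mono[OF return, of "2 * \<kappa>"] by linarith
qed

end

section \<open>The controlled process as a killed Markov chain\<close>

definition policy_kernel :: "('x::finite, 'u::finite) kernel \<Rightarrow> ('x, 'u) policy \<Rightarrow> 'x \<Rightarrow> 'x \<Rightarrow> real" where
  "policy_kernel p \<pi> x z = (\<Sum>u\<in>UNIV. pmf (\<pi> x) u * pmf (p x u) z)"

definition policy_payoff :: "('x::finite, 'u::finite) policy \<Rightarrow> ('x \<Rightarrow> 'u \<Rightarrow> real) \<Rightarrow> 'x \<Rightarrow> real" where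
  "policy_payoff \<pi> f x = (\<Sum>u\<in>UNIV. pmf (\<pi> x) u * f x u)"

lemma sum_pmf_UNIV: "(\<Sum>u\<in>(UNIV::'a::finite set). pmf q u) = 1"
  by (rule sum_pmf_eq_1) auto

lemma policy_payoff_bounds:
  assumes "\<And>x u. 0 \<le> f x u \<and> f x u \<le> 1"
  shows "0 \<le> policy_payoff \<pi> f x" and "policy_payoff \<pi> f x \<le> 1"
proof -
  have "policy_payoff \<pi> f x \<le> (\<Sum>u\<in>UNIV. pmf (\<pi> x) u)"
    unfolding policy_payoff_def by (intro sum_mono) (simp add: assms mult_left_le)
  then show "0 \<le> policy_payoff \<pi> f x" and "policy_payoff \<pi> f x \<le> 1"
    by (simp_all add: policy_payoff_def assms sum_nonneg sum_pmf_UNIV)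
qed

lemma space_trajectory: "space (trajectory p \<pi> \<mu>) = UNIV"
  using sets_eq_imp_space_eq[OF sets_trajectory] by (simp add: space_PiM)

lemma measurable_coordinate [measurable]:
  "(\<lambda>\<omega>. \<omega> t) \<in> measurable (trajectory p \<pi> \<mu>) (count_space UNIV)"
proof -
  have "(\<lambda>\<omega>. \<omega> t) \<in> measurable (PiM UNIV (\<lambda>_::nat. count_space UNIV)) (count_space UNIV)"
    by (rule measurable_component_singleton) simp
  then show ?thesis
    by (subst measurable_cong_sets[OF sets_trajectory refl])
qed

lemma sets_coordinate: "{\<omega>. R (\<omega> t)} \<in> sets (trajectory p \<pi> \<mu>)"
  using measurable_sets[OF measurable_coordinate, of "Collect R" t p \<pi> \<mu>]
  by (simp add: space_trajectory vimage_def)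

lemma sets_all_coordinates:
  "{\<omega>. \<forall>t\<in>I. R t (\<omega> t)} \<in> sets (trajectory p \<pi> \<mu>)" for I :: "nat set"
proof -
  have "{\<omega> \<in> space (trajectory p \<pi> \<mu>). \<forall>t\<in>I. R t (\<omega> t)} \<in> sets (trajectory p \<pi> \<mu>)"
    by (rule sets.sets_Collect_countable_Ball) (simp_all add: space_trajectory sets_coordinate)
  then show ?thesis
    by (simp add: space_trajectory)
qed

lemma trajectory_cylinder_measure:
  "measure (trajectory p \<pi> \<mu>) {\<omega>. \<forall>t<n. \<omega> t = s t} = (\<Prod>t<n. pmf (step p \<pi> \<mu> t s) (s t))"
  by (simp add: measure_def trajectory_cylinder prod_nonneg)

text \<open>
  Both events are disjoint unions of cylinders over the same finite set of paths of length
  \<open>Suc k\<close>, and the probability of a cylinder is a product over its steps.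
\<close>

lemma trajectory_markov:
  assumes past: "\<And>\<omega> \<omega>'. (\<And>t. t < Suc k \<Longrightarrow> \<omega> t = \<omega>' t) \<Longrightarrow> Q \<omega> \<longleftrightarrow> Q \<omega>'"
  shows "measure (trajectory p \<pi> \<mu>) {\<omega>. Q \<omega> \<and> \<omega> k = a \<and> \<omega> (Suc k) = b} =
    measure (trajectory p \<pi> \<mu>) {\<omega>. Q \<omega> \<and> \<omega> k = a} * pmf (with_action \<pi> (p (fst a) (snd a))) b"
proof -
  let ?T = "trajectory p \<pi> \<mu>"
  interpret T: prob_space ?T
    by (rule prob_space_trajectory)
  define S where "S = {s \<in> PiE {..<Suc k} (\<lambda>_. UNIV). Q s \<and> s k = a}"
  have S: "finite S"
    unfolding S_def by (rule finite_subset[OF _ finite_PiE[of "{..<Suc k}" "\<lambda>_. UNIV"]]) auto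
  have eq: "s = s'" if "s \<in> S" "s' \<in> S" "\<And>t. t < Suc k \<Longrightarrow> s t = s' t" for s s'
    using that by (intro PiE_ext[of s "{..<Suc k}" "\<lambda>_. UNIV" s']) (auto simp: S_def)
  have in_S: "restrict \<omega> {..<Suc k} \<in> S" if "Q \<omega>" "\<omega> k = a" for \<omega>
    using that past[of \<omega> "restrict \<omega> {..<Suc k}"] by (auto simp: S_def)
  have Q_S: "Q \<omega> \<and> \<omega> k = a" if "s \<in> S" "\<And>t. t < Suc k \<Longrightarrow> \<omega> t = s t" for s \<omega>
    using that past[of \<omega> s] by (auto simp: S_def)
  have cyl: "{\<omega>. \<forall>t<n. \<omega> t = s t} \<in> sets ?T" for n s
    using sets_all_coordinates[of "{..<n}" "\<lambda>t v. v = s t"] by (simp add: Ball_def)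
  have "{\<omega>. Q \<omega> \<and> \<omega> k = a} = (\<Union>s\<in>S. {\<omega>. \<forall>t<Suc k. \<omega> t = s t})"
  proof (intro set_eqI iffI)
    fix \<omega>
    assume "\<omega> \<in> {\<omega>. Q \<omega> \<and> \<omega> k = a}"
    then show "\<omega> \<in> (\<Union>s\<in>S. {\<omega>. \<forall>t<Suc k. \<omega> t = s t})"
      using in_S[of \<omega>] by (intro UN_I[of "restrict \<omega> {..<Suc k}"]) auto
  next
    fix \<omega>
    assume "\<omega> \<in> (\<Union>s\<in>S. {\<omega>. \<forall>t<Suc k. \<omega> t = s t})"
    then show "\<omega> \<in> {\<omega>. Q \<omega> \<and> \<omega> k = a}"
      using Q_S by blast
  qed
  moreover have "disjoint_family_on (\<lambda>s. {\<omega>. \<forall>t<Suc k. \<omega> t = s t}) S"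
    unfolding disjoint_family_on_def
  proof (intro ballI impI)
    fix s s'
    assume "s \<in> S" "s' \<in> S" "s \<noteq> s'"
    then obtain t where "t < Suc k" "s t \<noteq> s' t"
      using eq by blast
    then show "{\<omega>. \<forall>t<Suc k. \<omega> t = s t} \<inter> {\<omega>. \<forall>t<Suc k. \<omega> t = s' t} = {}"
      by auto
  qed
  ultimately have now: "measure ?T {\<omega>. Q \<omega> \<and> \<omega> k = a} =
      (\<Sum>s\<in>S. measure ?T {\<omega>. \<forall>t<Suc k. \<omega> t = s t})"
    using T.finite_measure_finite_Union[OF S, of "\<lambda>s. {\<omega>. \<forall>t<Suc k. \<omega> t = s t}"] cyl by auto
  define ext where "ext s = s(Suc k := b)" for s :: "nat \<Rightarrow> 'a \<times> 'b"
  have "{\<omega>. Q \<omega> \<and> \<omega> k = a \<and> \<omega> (Suc k) = b} = (\<Union>s\<in>S. {\<omega>. \<forall>t<Suc (Suc k). \<omega> t = ext s t})"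
  proof (intro set_eqI iffI)
    fix \<omega>
    assume "\<omega> \<in> {\<omega>. Q \<omega> \<and> \<omega> k = a \<and> \<omega> (Suc k) = b}"
    then show "\<omega> \<in> (\<Union>s\<in>S. {\<omega>. \<forall>t<Suc (Suc k). \<omega> t = ext s t})"
      using in_S[of \<omega>] by (intro UN_I[of "restrict \<omega> {..<Suc k}"]) (auto simp: ext_def)
  next
    fix \<omega>
    assume "\<omega> \<in> (\<Union>s\<in>S. {\<omega>. \<forall>t<Suc (Suc k). \<omega> t = ext s t})"
    then obtain s where s: "s \<in> S" "\<forall>t<Suc (Suc k). \<omega> t = ext s t"
      by blast
    then have "\<omega> t = s t" if "t < Suc k" for t
      using that by (auto simp: ext_def)
    with s Q_S[of s \<omega>] show "\<omega> \<in> {\<omega>. Q \<omega> \<and> \<omega> k = a \<and> \<omega> (Suc k) = b}"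
      by (simp add: ext_def)
  qed
  moreover have "disjoint_family_on (\<lambda>s. {\<omega>. \<forall>t<Suc (Suc k). \<omega> t = ext s t}) S"
    unfolding disjoint_family_on_def
  proof (intro ballI impI)
    fix s s'
    assume "s \<in> S" "s' \<in> S" "s \<noteq> s'"
    then obtain t where "t < Suc k" "s t \<noteq> s' t"
      using eq by blast
    then show "{\<omega>. \<forall>t<Suc (Suc k). \<omega> t = ext s t} \<inter> {\<omega>. \<forall>t<Suc (Suc k). \<omega> t = ext s' t} = {}"
      by (auto simp: ext_def intro!: exI[of _ t])
  qed
  ultimately have "measure ?T {\<omega>. Q \<omega> \<and> \<omega> k = a \<and> \<omega> (Suc k) = b} =
      (\<Sum>s\<in>S. measure ?T {\<omega>. \<forall>t<Suc (Suc k). \<omega> t = ext s t})"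
    using T.finite_measure_finite_Union[OF S, of "\<lambda>s. {\<omega>. \<forall>t<Suc (Suc k). \<omega> t = ext s t}"] cyl
    by auto
  also have "\<dots> = (\<Sum>s\<in>S. measure ?T {\<omega>. \<forall>t<Suc k. \<omega> t = s t} *
      pmf (with_action \<pi> (p (fst a) (snd a))) b)"
  proof (rule sum.cong[OF refl])
    fix s
    assume "s \<in> S"
    then have "s k = a"
      by (simp add: S_def)
    have "pmf (step p \<pi> \<mu> t (ext s)) (ext s t) = pmf (step p \<pi> \<mu> t s) (s t)" if "t < Suc k" for t
      using that by (auto simp: ext_def step_def split: nat.split)
    moreover have "pmf (step p \<pi> \<mu> (Suc k) (ext s)) (ext s (Suc k)) =
        pmf (with_action \<pi> (p (fst a) (snd a))) b"
      using \<open>s k = a\<close> by (simp add: ext_def step_def)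
    ultimately show "measure ?T {\<omega>. \<forall>t<Suc (Suc k). \<omega> t = ext s t} =
        measure ?T {\<omega>. \<forall>t<Suc k. \<omega> t = s t} * pmf (with_action \<pi> (p (fst a) (snd a))) b"
      unfolding trajectory_cylinder_measure prod.lessThan_Suc[of _ "Suc k"] by simp
  qed
  finally show ?thesis
    by (simp add: now sum_distrib_right)
qed

lemma measure_by_coordinate:
  fixes R :: "(nat \<Rightarrow> 'x::finite \<times> 'u::finite) \<Rightarrow> bool"
  assumes "{\<omega>. R \<omega>} \<in> sets (trajectory p \<pi> \<mu>)"
  shows "measure (trajectory p \<pi> \<mu>) {\<omega>. R \<omega>} =
    (\<Sum>a\<in>UNIV. measure (trajectory p \<pi> \<mu>) {\<omega>. R \<omega> \<and> \<omega> t = a})"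
proof -
  interpret T: prob_space "trajectory p \<pi> \<mu>"
    by (rule prob_space_trajectory)
  have "{\<omega>. R \<omega> \<and> \<omega> t = a} \<in> sets (trajectory p \<pi> \<mu>)" for a
    using sets.Int[OF assms sets_coordinate[of "\<lambda>v. v = a" t]] by (simp add: Collect_conj_eq)
  moreover have "disjoint_family (\<lambda>a. {\<omega>. R \<omega> \<and> \<omega> t = a})"
    by (auto simp: disjoint_family_on_def)
  ultimately have "measure (trajectory p \<pi> \<mu>) (\<Union>a. {\<omega>. R \<omega> \<and> \<omega> t = a}) =
      (\<Sum>a\<in>UNIV. measure (trajectory p \<pi> \<mu>) {\<omega>. R \<omega> \<and> \<omega> t = a})"
    by (intro T.finite_measure_finite_Union) (simp_all add: image_subset_iff)
  moreover have "(\<Union>a. {\<omega>. R \<omega> \<and> \<omega> t = a}) = {\<omega>. R \<omega>}"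
    by auto
  ultimately show ?thesis
    by simp
qed

lemma sum_UNIV_prod:
  "(\<Sum>a\<in>(UNIV::('x::finite \<times> 'u::finite) set). f a) = (\<Sum>x\<in>UNIV. \<Sum>u\<in>UNIV. f (x, u))"
  by (simp add: sum.cartesian_product UNIV_Times_UNIV[symmetric] del: UNIV_Times_UNIV)

text \<open>
  Actions are drawn afresh from \<open>\<pi>\<close> at the current state, so the joint law of state and action factors
  and the state component obeys the recursion of \<open>killed_law\<close>. The case \<open>Y = {}\<close> is the plain law of
  the process, and \<open>Y = {y}\<close> describes the hitting time of \<open>y\<close>.
\<close>

lemma measure_killed_trajectory:
  fixes p :: "('x::finite, 'u::finite) kernel"
  shows "measure (trajectory p \<pi> \<mu>) {\<omega>. (\<forall>t\<in>{1..k}. fst (\<omega> t) \<notin> Y) \<and> \<omega> k = (z, u)} =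
    killed_law (policy_kernel p \<pi>) Y (pmf \<mu>) k z * pmf (\<pi> z) u"
proof (induction k arbitrary: z u)
  case 0
  show ?case
    using trajectory_cylinder_measure[of p \<pi> \<mu> "Suc 0" "\<lambda>_. (z, u)"]
    by (simp add: step_def pmf_with_action)
next
  case (Suc k)
  let ?T = "trajectory p \<pi> \<mu>"
  let ?Q = "\<lambda>\<omega>. \<forall>t\<in>{1..k}. fst (\<omega> t) \<notin> Y"
  show ?case
  proof (cases "z \<in> Y")
    case True
    then have empty: "{\<omega>. (\<forall>t\<in>{1..Suc k}. fst (\<omega> t) \<notin> Y) \<and> \<omega> (Suc k) = (z, u)} = {}"
      by force
    from True show ?thesis
      unfolding empty by simp
  next
    case False
    have Q: "{\<omega>. ?Q \<omega> \<and> \<omega> (Suc k) = (z, u)} \<in> sets ?T"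
      using sets.Int[OF sets_all_coordinates[of "{1..k}" "\<lambda>t v. fst v \<notin> Y"]
          sets_coordinate[of "\<lambda>v. v = (z, u)" "Suc k"]]
      by (simp add: Collect_conj_eq)
    have "{\<omega>. (\<forall>t\<in>{1..Suc k}. fst (\<omega> t) \<notin> Y) \<and> \<omega> (Suc k) = (z, u)} =
        {\<omega>. ?Q \<omega> \<and> \<omega> (Suc k) = (z, u)}"
      using False by (auto simp: atLeastAtMostSuc_conv)
    then have "measure ?T {\<omega>. (\<forall>t\<in>{1..Suc k}. fst (\<omega> t) \<notin> Y) \<and> \<omega> (Suc k) = (z, u)} =
        (\<Sum>a\<in>UNIV. measure ?T {\<omega>. (?Q \<omega> \<and> \<omega> (Suc k) = (z, u)) \<and> \<omega> k = a})"
      using measure_by_coordinate[OF Q, of k] by simp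
    also have "\<dots> = (\<Sum>a\<in>UNIV. measure ?T {\<omega>. ?Q \<omega> \<and> \<omega> k = a \<and> \<omega> (Suc k) = (z, u)})"
      by (intro sum.cong refl arg_cong[where f = "measure ?T"]) auto
    also have "\<dots> = (\<Sum>a\<in>UNIV. measure ?T {\<omega>. ?Q \<omega> \<and> \<omega> k = a} *
        pmf (with_action \<pi> (p (fst a) (snd a))) (z, u))"
      by (intro sum.cong refl trajectory_markov) auto
    also have "\<dots> = (\<Sum>w\<in>UNIV. \<Sum>v\<in>UNIV. killed_law (policy_kernel p \<pi>) Y (pmf \<mu>) k w * pmf (\<pi> w) v *
        (pmf (p w v) z * pmf (\<pi> z) u))"
      using Suc.IH by (simp add: sum_UNIV_prod pmf_with_action)
    also have "\<dots> = killed_law (policy_kernel p \<pi>) Y (pmf \<mu>) (Suc k) z * pmf (\<pi> z) u"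
      using False by (simp add: policy_kernel_def sum_distrib_left sum_distrib_right mult.assoc)
    finally show ?thesis .
  qed
qed

lemma measure_avoid:
  fixes p :: "('x::finite, 'u::finite) kernel"
  shows "measure (trajectory p \<pi> \<mu>) {\<omega>. \<forall>t\<in>{1..k}. fst (\<omega> t) \<notin> Y} =
    (\<Sum>x\<in>UNIV. pmf \<mu> x * survival (policy_kernel p \<pi>) Y k x)"
proof -
  have "measure (trajectory p \<pi> \<mu>) {\<omega>. \<forall>t\<in>{1..k}. fst (\<omega> t) \<notin> Y} =
      (\<Sum>z\<in>UNIV. \<Sum>u\<in>UNIV. killed_law (policy_kernel p \<pi>) Y (pmf \<mu>) k z * pmf (\<pi> z) u)"
    using measure_by_coordinate[OF sets_all_coordinates[of "{1..k}" "\<lambda>t v. fst v \<notin> Y"], of p \<pi> \<mu> k]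
    by (simp only: sum_UNIV_prod measure_killed_trajectory)
  also have "\<dots> = (\<Sum>z\<in>UNIV. killed_law (policy_kernel p \<pi>) Y (pmf \<mu>) k z)"
    by (simp add: sum_pmf_UNIV flip: sum_distrib_left)
  finally show ?thesis
    by (simp add: sum_killed_law)
qed

lemma expect_at_eq:
  fixes p :: "('x::finite, 'u::finite) kernel"
  shows "expect_at p \<mu> \<pi> f t =
    (\<Sum>z\<in>UNIV. killed_law (policy_kernel p \<pi>) {} (pmf \<mu>) t z * policy_payoff \<pi> f z)"
proof -
  let ?T = "trajectory p \<pi> \<mu>"
  interpret T: prob_space ?T
    by (rule prob_space_trajectory)
  have "f (fst (\<omega> t)) (snd (\<omega> t)) =
      (\<Sum>a\<in>UNIV. f (fst a) (snd a) * indicator {\<omega>. \<omega> t = a} \<omega>)" for \<omega> :: "nat \<Rightarrow> 'x \<times> 'u"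
    by (simp add: sum.remove[of _ "\<omega> t"] indicator_def)
  then have "expect_at p \<mu> \<pi> f t =
      (\<integral>\<omega>. (\<Sum>a\<in>UNIV. f (fst a) (snd a) * indicator {\<omega>. \<omega> t = a} \<omega>) \<partial>?T)"
    by (simp add: expect_at_def)
  also have "\<dots> = (\<Sum>a\<in>UNIV. f (fst a) (snd a) * measure ?T {\<omega>. \<omega> t = a})"
    using sets_coordinate[of _ t p \<pi> \<mu>]
    by (subst Bochner_Integration.integral_sum) (simp_all add: T.emeasure_eq_measure space_trajectory)
  also have "\<dots> = (\<Sum>z\<in>UNIV. \<Sum>u\<in>UNIV. f z u * (killed_law (policy_kernel p \<pi>) {} (pmf \<mu>) t z * pmf (\<pi> z) u))"
    using measure_killed_trajectory[of p \<pi> \<mu> t "{}"] by (simp add: sum_UNIV_prod)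
  also have "\<dots> = (\<Sum>z\<in>UNIV. killed_law (policy_kernel p \<pi>) {} (pmf \<mu>) t z * policy_payoff \<pi> f z)"
    by (simp add: policy_payoff_def sum_distrib_left mult_ac)
  finally show ?thesis .
qed

lemma hitting_time_greater: "enat k < hitting_time y \<omega> \<longleftrightarrow> (\<forall>t\<in>{1..k}. fst (\<omega> t) \<noteq> y)"
proof
  assume "enat k < hitting_time y \<omega>"
  then show "\<forall>t\<in>{1..k}. fst (\<omega> t) \<noteq> y"
  proof (intro ballI notI)
    fix t
    assume "t \<in> {1..k}" "fst (\<omega> t) = y"
    then have "hitting_time y \<omega> \<le> enat t"
      unfolding hitting_time_def by (intro Inf_lower) auto
    also have "enat t \<le> enat k"
      using \<open>t \<in> {1..k}\<close> by simp
    finally show False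
      using \<open>enat k < hitting_time y \<omega>\<close> by simp
  qed
next
  assume "\<forall>t\<in>{1..k}. fst (\<omega> t) \<noteq> y"
  then have "enat (Suc k) \<le> hitting_time y \<omega>"
    unfolding hitting_time_def by (intro Inf_greatest) (force simp: not_less_eq_eq[symmetric])
  then show "enat k < hitting_time y \<omega>"
    by (metis enat_ord_simps(2) less_le_trans lessI)
qed

lemma sets_hitting_time_greater: "{\<omega>. enat k < hitting_time y \<omega>} \<in> sets (trajectory p \<pi> \<mu>)"
  unfolding hitting_time_greater using sets_all_coordinates[of "{1..k}" "\<lambda>t v. fst v \<noteq> y"] by simp

lemma measurable_hitting_time:
  fixes p :: "('x::finite, 'u::finite) kernel"
  shows "hitting_time y \<in> measurable (trajectory p \<pi> \<mu>) (count_space UNIV)"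
proof (subst measurable_count_space_eq2_countable, safe)
  fix n :: enat
  let ?T = "trajectory p \<pi> \<mu>"
  have "{\<omega>. hitting_time y \<omega> = n} \<in> sets ?T"
  proof (cases n)
    case infinity
    have "{\<omega> :: nat \<Rightarrow> 'x \<times> 'u. hitting_time y \<omega> = n} = (\<Inter>k. {\<omega>. enat k < hitting_time y \<omega>})"
      unfolding infinity by (auto, metis enat.exhaust less_irrefl)
    moreover have "(\<Inter>k. {\<omega>. enat k < hitting_time y \<omega>}) \<in> sets ?T"
      by (intro sets.countable_INT) (auto simp: sets_hitting_time_greater)
    ultimately show ?thesis
      by simp
  next
    case (enat m)
    show ?thesis
    proof (cases m)
      case 0
      then have "{\<omega> :: nat \<Rightarrow> 'x \<times> 'u. hitting_time y \<omega> = n} = space ?T - {\<omega>. enat 0 < hitting_time y \<omega>}"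
        by (auto simp: enat space_trajectory zero_enat_def[symmetric])
      then show ?thesis
        using sets_hitting_time_greater by (metis sets.compl_sets)
    next
      case (Suc k)
      have "h = enat (Suc k) \<longleftrightarrow> enat k < h \<and> \<not> enat (Suc k) < h" for h
        by (cases h) auto
      then have "{\<omega> :: nat \<Rightarrow> 'x \<times> 'u. hitting_time y \<omega> = n} =
          {\<omega>. enat k < hitting_time y \<omega>} - {\<omega>. enat (Suc k) < hitting_time y \<omega>}"
        unfolding enat Suc by blast
      then show ?thesis
        using sets_hitting_time_greater by (metis sets.Diff)
    qed
  qed
  then show "hitting_time y -` {n} \<inter> space ?T \<in> sets ?T"
    by (simp add: vimage_def space_trajectory)
qed auto

lemma expected_hit_eq:
  "expected_hit p \<pi> x y = (\<Sum>k. ennreal (survival (policy_kernel p \<pi>) {y} k x))"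
proof -
  let ?T = "trajectory p \<pi> (return_pmf x)"
  interpret T: prob_space ?T
    by (rule prob_space_trajectory)
  have "expected_hit p \<pi> x y = (\<Sum>k. emeasure ?T {\<omega>. enat k < hitting_time y \<omega>})"
    unfolding expected_hit_def by (subst nn_integral_enat_function[OF measurable_hitting_time])
      (simp add: space_trajectory)
  also have "\<dots> = (\<Sum>k. ennreal (survival (policy_kernel p \<pi>) {y} k x))"
    using measure_avoid[of p \<pi> "return_pmf x" _ "{y}"]
    by (simp add: T.emeasure_eq_measure hitting_time_greater indicator_def sum.remove[of _ x])
  finally show ?thesis .
qed

section \<open>Gains and hitting times of stationary policies\<close>

locale unichain_mdp =
  fixes p :: "('x::finite, 'u::finite) kernel"
  assumes unichain: "unichain p"
begin

lemma hitting_chain_policy_kernel: "hitting_chain (policy_kernel p \<pi>)"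
proof
  show "0 \<le> policy_kernel p \<pi> x z" for x z
    by (simp add: policy_kernel_def sum_nonneg)
  show "(\<Sum>z\<in>UNIV. policy_kernel p \<pi> x z) = 1" for x
    unfolding policy_kernel_def
    by (subst sum.swap) (simp add: sum_pmf_UNIV flip: sum_distrib_left)
  have nonneg: "0 \<le> survival (policy_kernel p \<pi>) {y} k x" for k x y
    by (induction k arbitrary: x)
      (auto intro!: sum_nonneg mult_nonneg_nonneg simp: policy_kernel_def)
  show "summable (\<lambda>k. survival (policy_kernel p \<pi>) {y} k x)" for x y
  proof (rule summable_suminf_not_top[OF nonneg])
    have "expected_hit p \<pi> x y < \<infinity>"
      using unichain by (simp add: unichain_def)
    then show "(\<Sum>k. ennreal (survival (policy_kernel p \<pi>) {y} k x)) \<noteq> top"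
      by (simp add: expected_hit_eq)
  qed
qed

sublocale chain: hitting_chain "policy_kernel p \<pi>" for \<pi>
  by (rule hitting_chain_policy_kernel)

lemma expected_hit_mean_hit: "expected_hit p \<pi> x y = ennreal (chain.mean_hit \<pi> x y)"
  unfolding expected_hit_eq chain.mean_hit_def
  by (rule suminf_ennreal_eq) (auto simp: chain.survival_nonneg intro: summable_sums chain.summable_survival)

definition gain :: "('x, 'u) policy \<Rightarrow> ('x \<Rightarrow> 'u \<Rightarrow> real) \<Rightarrow> real" where
  "gain \<pi> f = (\<Sum>y\<in>UNIV. chain.stat \<pi> y * policy_payoff \<pi> f y)"

lemma averages_tendsto_gain:
  "(\<lambda>T. ereal (1 / real T * (\<Sum>t=1..T. expect_at p \<mu> \<pi> f t))) \<longlonglongrightarrow> ereal (gain \<pi> f)"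
  unfolding gain_def expect_at_eq
  by (intro tendsto_ereal chain.cesaro_average) (auto simp: sum_pmf_UNIV)

lemma avg_reward_eq_gain: "avg_reward p \<mu> f \<pi> = gain \<pi> f"
  unfolding avg_reward_def
  using lim_imp_Liminf[OF trivial_limit_sequentially averages_tendsto_gain[of \<mu> \<pi> f]] by simp

lemma avg_cost_eq_gain: "avg_cost p \<mu> f \<pi> = gain \<pi> f"
  unfolding avg_cost_def
  using lim_imp_Limsup[OF trivial_limit_sequentially averages_tendsto_gain[of \<mu> \<pi> f]] by simp

lemma policy_kernel_return:
  "policy_kernel p (\<lambda>x. return_pmf (d x)) x z = pmf (p x (d x)) z"
  by (simp add: policy_kernel_def indicator_def sum.remove[of _ "d x"])

lemma policy_kernel_pairing:
  "(\<Sum>z\<in>A. policy_kernel p \<pi> x z * h z) = (\<Sum>u\<in>UNIV. pmf (\<pi> x) u * (\<Sum>z\<in>A. pmf (p x u) z * h z))"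
proof -
  have "(\<Sum>z\<in>A. policy_kernel p \<pi> x z * h z) =
      (\<Sum>z\<in>A. \<Sum>u\<in>UNIV. pmf (\<pi> x) u * (pmf (p x u) z * h z))"
    by (simp add: policy_kernel_def sum_distrib_right mult.assoc)
  also have "\<dots> = (\<Sum>u\<in>UNIV. \<Sum>z\<in>A. pmf (\<pi> x) u * (pmf (p x u) z * h z))"
    by (rule sum.swap)
  finally show ?thesis
    by (simp add: sum_distrib_left)
qed

text \<open>
  Take a deterministic policy that maximizes the sum of the mean hitting times over all starting points.
  If changing its action at one state increased the right-hand side of the first-step equation, the
  old hitting times would be a subsolution for the changed policy, which would therefore have a larger
  sum. So its hitting times are a supersolution for every action, hence for every randomized
  policy.
\<close>

lemma deterministic_policy_maximizes_mean_hit: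
  "\<exists>d. \<forall>\<pi> x. chain.mean_hit \<pi> x y \<le> chain.mean_hit (\<lambda>x. return_pmf (d x)) x y"
proof -
  define m where "m d x = chain.mean_hit (\<lambda>x. return_pmf (d x)) x y" for d :: "'x \<Rightarrow> 'u" and x
  have m_step: "m d x = 1 + (\<Sum>z\<in>-{y}. pmf (p x (d x)) z * m d z)" for d x
    unfolding m_def
    using chain.mean_hit_killed_first_step[of "\<lambda>x. return_pmf (d x)" x y] by (simp add: policy_kernel_return)
  define total where "total d = (\<Sum>x\<in>UNIV. m d x)" for d
  have "Max (range total) \<in> range total"
    by (rule Max_in) auto
  then obtain d where d: "total d = Max (range total)"
    by (metis imageE)
  have best: "total d' \<le> total d" for d'
    unfolding d by (rule Max_ge) auto
  have no_improvement: "1 + (\<Sum>z\<in>-{y}. pmf (p x u) z * m d z) \<le> m d x" for x u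
  proof (rule ccontr)
    assume "\<not> ?thesis"
    then have gt: "m d x < 1 + (\<Sum>z\<in>-{y}. pmf (p x u) z * m d z)"
      by simp
    define d' where "d' = d(x := u)"
    have ge: "m d w \<le> m d' w" for w
      unfolding m_def[of d']
    proof (rule chain.mean_hit_ge_subsolution)
      fix w
      show "m d w \<le> 1 + (\<Sum>z\<in>-{y}. policy_kernel p (\<lambda>x. return_pmf (d' x)) w z * m d z)"
        using gt m_step[of d w] by (cases "w = x") (auto simp: policy_kernel_return d'_def)
    qed
    have "m d x < 1 + (\<Sum>z\<in>-{y}. pmf (p x u) z * m d z)"
      by (rule gt)
    also have "\<dots> \<le> 1 + (\<Sum>z\<in>-{y}. pmf (p x u) z * m d' z)"
      by (intro add_left_mono sum_mono mult_left_mono ge) auto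
    also have "\<dots> = m d' x"
      by (subst (2) m_step) (simp add: d'_def)
    finally have "total d < total d'"
      unfolding total_def using ge by (intro sum_strict_mono_ex1) auto
    then show False
      using best[of d'] by simp
  qed
  have "chain.mean_hit \<pi> x y \<le> m d x" for \<pi> x
  proof (rule chain.mean_hit_le_supersolution)
    fix x
    have "1 + (\<Sum>z\<in>-{y}. policy_kernel p \<pi> x z * m d z) =
        (\<Sum>u\<in>UNIV. pmf (\<pi> x) u * (1 + (\<Sum>z\<in>-{y}. pmf (p x u) z * m d z)))"
      by (simp add: policy_kernel_pairing distrib_left sum.distrib sum_pmf_UNIV)
    also have "\<dots> \<le> (\<Sum>u\<in>UNIV. pmf (\<pi> x) u * m d x)"
      by (intro sum_mono mult_left_mono no_improvement) auto
    finally show "1 + (\<Sum>z\<in>-{y}. policy_kernel p \<pi> x z * m d z) \<le> m d x"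
      by (simp add: sum_pmf_UNIV flip: sum_distrib_right)
  qed
  then show ?thesis
    unfolding m_def by blast
qed

lemma mean_hit_bounded: "\<exists>C. \<forall>\<pi> x y. chain.mean_hit \<pi> x y \<le> C"
proof -
  obtain d where d: "\<And>y \<pi> x. chain.mean_hit \<pi> x y \<le> chain.mean_hit (\<lambda>x. return_pmf (d y x)) x y"
    using deterministic_policy_maximizes_mean_hit by metis
  let ?m = "\<lambda>x y. chain.mean_hit (\<lambda>x. return_pmf (d y x)) x y"
  have "?m x y \<le> (\<Sum>x\<in>UNIV. \<Sum>y\<in>UNIV. ?m x y)" for x y
  proof -
    have pos: "0 \<le> ?m x y" for x y
      using chain.mean_hit_ge_1[of "\<lambda>x. return_pmf (d y x)" x y] by linarith
    have "?m x y \<le> (\<Sum>y\<in>UNIV. ?m x y)"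
      by (rule member_le_sum) (auto simp: pos)
    also have "\<dots> \<le> (\<Sum>x\<in>UNIV. \<Sum>y\<in>UNIV. ?m x y)"
      by (rule member_le_sum[where f = "\<lambda>x. \<Sum>y\<in>UNIV. ?m x y"]) (auto simp: pos sum_nonneg)
    finally show ?thesis .
  qed
  then show ?thesis
    using d order_trans by blast
qed

text \<open>
  Besides unfolding the definition, this needs the supremum to be finite, since \<open>enn2real\<close> sends
  \<open>\<infinity>\<close> to \<open>0\<close>. The uniform bound on the hitting times provides that, as return times are at least \<open>1\<close>.
\<close>

lemma mean_hit_le_conductivity:
  assumes card: "2 \<le> CARD('x)" and "x \<noteq> y"
  shows "chain.mean_hit \<pi> x y \<le> 2 * conductivity p * chain.mean_hit \<pi> x x"
proof -
  let ?ratio = "\<lambda>\<pi> x. (MAX y\<in>-{x}. expected_hit p \<pi> x y) / (2 * expected_hit p \<pi> x x)"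
  define S where "S = (SUP \<pi>. MAX x. ?ratio \<pi> x)"
  have ratio: "ennreal (chain.mean_hit \<pi> x y) / (2 * expected_hit p \<pi> x x) =
      ennreal (chain.mean_hit \<pi> x y / (2 * chain.mean_hit \<pi> x x))" for \<pi> x y
  proof -
    have "2 * expected_hit p \<pi> x x = ennreal (2 * chain.mean_hit \<pi> x x)"
      by (simp add: expected_hit_mean_hit ennreal_mult')
    then show ?thesis
      using chain.mean_hit_ge_1[of \<pi> x y] chain.mean_hit_ge_1[of \<pi> x x]
      by (simp add: divide_ennreal)
  qed
  obtain C where C: "\<And>\<pi> x y. chain.mean_hit \<pi> x y \<le> C"
    using mean_hit_bounded by blast
  have ratio_le: "?ratio \<pi> x \<le> ennreal C" for \<pi> x
  proof -
    have "-{x} \<noteq> {}"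
      using card by (metis Compl_empty_eq Compl_eq_Compl_iff One_nat_def Suc_1 card_1_singleton_iff not_less_eq_eq order_refl double_complement)
    then have "(MAX y\<in>-{x}. expected_hit p \<pi> x y) \<in> (\<lambda>y. expected_hit p \<pi> x y) ` (-{x})"
      by (intro Max_in) auto
    then obtain y where "(MAX y\<in>-{x}. expected_hit p \<pi> x y) = ennreal (chain.mean_hit \<pi> x y)"
      by (auto simp: expected_hit_mean_hit)
    then have "?ratio \<pi> x = ennreal (chain.mean_hit \<pi> x y / (2 * chain.mean_hit \<pi> x x))"
      by (simp add: ratio)
    also have "\<dots> \<le> ennreal (chain.mean_hit \<pi> x y)"
      using chain.mean_hit_ge_1[of \<pi> x y] chain.mean_hit_ge_1[of \<pi> x x]
      by (intro ennreal_leI) (simp add: divide_le_eq)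
    also have "\<dots> \<le> ennreal C"
      by (rule ennreal_leI[OF C])
    finally show ?thesis .
  qed
  have "S \<le> ennreal C"
    unfolding S_def by (intro SUP_least Max.boundedI) (auto simp: ratio_le)
  then have S: "S = ennreal (conductivity p)"
    by (auto simp: conductivity_def S_def[symmetric] ennreal_enn2real_if top_unique)
  have "ennreal (chain.mean_hit \<pi> x y) \<le> (MAX y\<in>-{x}. expected_hit p \<pi> x y)"
    unfolding expected_hit_mean_hit[symmetric] using \<open>x \<noteq> y\<close> by (intro Max_ge) auto
  then have "ennreal (chain.mean_hit \<pi> x y / (2 * chain.mean_hit \<pi> x x)) \<le> ?ratio \<pi> x"
    unfolding ratio[symmetric] by (rule divide_right_mono_ennreal)
  also have "\<dots> \<le> (MAX x. ?ratio \<pi> x)"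
    by (rule Max_ge) auto
  also have "\<dots> \<le> S"
    unfolding S_def by (rule SUP_upper) simp
  finally have "ennreal (chain.mean_hit \<pi> x y / (2 * chain.mean_hit \<pi> x x)) \<le> ennreal (conductivity p)"
    by (simp only: S)
  then have "chain.mean_hit \<pi> x y / (2 * chain.mean_hit \<pi> x x) \<le> conductivity p"
    by (subst (asm) ennreal_le_iff) (auto simp: conductivity_def)
  then show ?thesis
    using chain.mean_hit_ge_1[of \<pi> x x] by (simp add: divide_le_eq mult_ac)
qed

section \<open>Perturbation and mixing of policies\<close>

text \<open>
  Following \<open>\<pi>\<close> for one step and collecting \<open>h\<close> afterwards is worth \<open>h y + gain \<pi> f\<close> on average, by
  the Poisson equation. Averaged over the stationary distribution of \<open>\<pi>'\<close>, the same expression with \<open>\<pi>'\<close>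
  in place of \<open>\<pi>\<close> gives \<open>gain \<pi>' f\<close> plus the stationary mean of \<open>h\<close>, and that mean cancels.
\<close>

lemma performance_difference:
  assumes h: "h = chain.bias \<pi> (policy_payoff \<pi> f)"
  shows "gain \<pi>' f - gain \<pi> f =
    (\<Sum>y\<in>UNIV. chain.stat \<pi>' y *
       (\<Sum>u\<in>UNIV. (pmf (\<pi>' y) u - pmf (\<pi> y) u) * (f y u + (\<Sum>z\<in>UNIV. pmf (p y u) z * h z))))"
proof -
  have lookahead: "(\<Sum>u\<in>UNIV. pmf (\<sigma> y) u * (f y u + (\<Sum>z\<in>UNIV. pmf (p y u) z * h z))) =
      policy_payoff \<sigma> f y + (\<Sum>z\<in>UNIV. policy_kernel p \<sigma> y z * h z)" for \<sigma> y
    by (simp add: policy_kernel_pairing policy_payoff_def distrib_left sum.distrib)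
  have poisson: "policy_payoff \<pi> f y + (\<Sum>z\<in>UNIV. policy_kernel p \<pi> y z * h z) = h y + gain \<pi> f" for y
    using chain.poisson_equation[of \<pi> "policy_payoff \<pi> f" y] by (simp add: h gain_def)
  have "(\<Sum>y\<in>UNIV. chain.stat \<pi>' y *
       (\<Sum>u\<in>UNIV. (pmf (\<pi>' y) u - pmf (\<pi> y) u) * (f y u + (\<Sum>z\<in>UNIV. pmf (p y u) z * h z)))) =
     (\<Sum>y\<in>UNIV. chain.stat \<pi>' y *
       (policy_payoff \<pi>' f y + (\<Sum>z\<in>UNIV. policy_kernel p \<pi>' y z * h z) - (h y + gain \<pi> f)))"
    by (simp only: left_diff_distrib sum_subtractf lookahead poisson)
  also have "\<dots> = gain \<pi>' f +
      (\<Sum>y\<in>UNIV. chain.stat \<pi>' y * (\<Sum>z\<in>UNIV. policy_kernel p \<pi>' y z * h z)) -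
      ((\<Sum>y\<in>UNIV. chain.stat \<pi>' y * h y) + (\<Sum>y\<in>UNIV. chain.stat \<pi>' y) * gain \<pi> f)"
    by (simp add: gain_def[of \<pi>'] distrib_left right_diff_distrib sum.distrib sum_subtractf
        sum_distrib_right)
  also have "\<dots> = gain \<pi>' f - gain \<pi> f"
    by (simp add: chain.stationary_pairing[OF chain.stationary_stat] chain.sum_stat)
  finally show ?thesis ..
qed

lemma conductivity_nonneg: "0 \<le> conductivity p"
  by (simp add: conductivity_def)

text \<open>
  In the performance difference formula the second factor ranges over an interval of length
  \<open>1 + K\<close> for Kemeny's constant \<open>K\<close>, and both \<open>1\<close> and \<open>K\<close> are controlled by the conductivity.
\<close>

lemma gain_perturbation:
  assumes card: "2 \<le> CARD('x)"
    and f: "\<And>x u. 0 \<le> f x u \<and> f x u \<le> 1"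
    and close: "\<And>x. l1_dist (\<pi> x) (\<pi>' x) \<le> \<epsilon>"
  shows "\<bar>gain \<pi>' f - gain \<pi> f\<bar> \<le> \<epsilon> * conductivity p * (real CARD('x))\<^sup>2"
proof -
  define n where "n = real CARD('x)"
  define h where "h = chain.bias \<pi> (policy_payoff \<pi> f)"
  define Q where "Q y u = f y u + (\<Sum>z\<in>UNIV. pmf (p y u) z * h z)" for y u
  define K where "K = chain.kemeny \<pi>"
  have "0 \<le> l1_dist (\<pi> undefined) (\<pi>' undefined)"
    by (simp add: l1_dist_def sum_nonneg)
  then have \<epsilon>: "0 \<le> \<epsilon>"
    using close[of undefined] by linarith
  have h_bounds: "- K \<le> h z" "h z \<le> 0" for z
    unfolding h_def K_def by (intro chain.bias_bounds policy_payoff_bounds f)+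
  have Q_bounds: "- K \<le> Q y u" "Q y u \<le> - K + (1 + K)" for y u
  proof -
    have "(\<Sum>z\<in>UNIV. pmf (p y u) z * - K) \<le> (\<Sum>z\<in>UNIV. pmf (p y u) z * h z)"
      by (intro sum_mono mult_left_mono h_bounds) auto
    moreover have "(\<Sum>z\<in>UNIV. pmf (p y u) z * h z) \<le> 0"
      by (intro sum_nonpos mult_nonneg_nonpos h_bounds) auto
    ultimately show "- K \<le> Q y u" "Q y u \<le> - K + (1 + K)"
      using f[of y u] by (simp_all add: Q_def sum_pmf_UNIV sum_negf flip: sum_distrib_right)
  qed
  have K: "0 \<le> K"
    using h_bounds[of undefined] by linarith
  have local: "\<bar>\<Sum>u\<in>UNIV. (pmf (\<pi>' y) u - pmf (\<pi> y) u) * Q y u\<bar> \<le> (1 + K) / 2 * \<epsilon>" for y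
  proof -
    have "\<bar>\<Sum>u\<in>UNIV. (pmf (\<pi>' y) u - pmf (\<pi> y) u) * Q y u\<bar> \<le>
        (1 + K) / 2 * (\<Sum>u\<in>UNIV. \<bar>pmf (\<pi>' y) u - pmf (\<pi> y) u\<bar>)"
      by (rule abs_sum_mult_le_half_l1[OF _ Q_bounds]) (simp add: sum_subtractf sum_pmf_UNIV)
    also have "\<dots> \<le> (1 + K) / 2 * \<epsilon>"
      using close[of y] K by (intro mult_left_mono) (auto simp: l1_dist_def abs_minus_commute)
    finally show ?thesis .
  qed
  have "\<bar>gain \<pi>' f - gain \<pi> f\<bar> =
      \<bar>\<Sum>y\<in>UNIV. chain.stat \<pi>' y * (\<Sum>u\<in>UNIV. (pmf (\<pi>' y) u - pmf (\<pi> y) u) * Q y u)\<bar>"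
    unfolding performance_difference[OF h_def] Q_def ..
  also have "\<dots> \<le> (\<Sum>y\<in>UNIV. chain.stat \<pi>' y * ((1 + K) / 2 * \<epsilon>))"
    by (rule order_trans[OF sum_abs], rule sum_mono)
      (simp only: abs_mult abs_of_nonneg[OF chain.stat_nonneg] mult_left_mono[OF local chain.stat_nonneg])
  also have "\<dots> = (1 + K) / 2 * \<epsilon>"
    by (simp only: chain.sum_stat mult_1_left flip: sum_distrib_right)
  also have "\<dots> \<le> conductivity p * (2 * n - 1) * \<epsilon>"
  proof (rule mult_right_mono[OF _ \<epsilon>])
    have "1 \<le> 2 * conductivity p * n"
      unfolding n_def by (rule chain.one_le_conductivity[OF card mean_hit_le_conductivity[OF card]])
    moreover have "K \<le> 2 * conductivity p * (n - 1)"
      unfolding K_def n_def by (rule chain.kemeny_le[OF mean_hit_le_conductivity[OF card]])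
    moreover have "2 * conductivity p * n + 2 * conductivity p * (n - 1) = 2 * (conductivity p * (2 * n - 1))"
      by (simp add: algebra_simps)
    ultimately have "1 + K \<le> 2 * (conductivity p * (2 * n - 1))"
      using add_mono by metis
    then show "(1 + K) / 2 \<le> conductivity p * (2 * n - 1)"
      by simp
  qed
  also have "\<dots> \<le> conductivity p * n\<^sup>2 * \<epsilon>"
  proof -
    have "2 * n - 1 \<le> n\<^sup>2"
      using zero_le_power2[of "n - 1"] by (simp add: power2_diff)
    then show ?thesis
      by (intro mult_right_mono[OF _ \<epsilon>] mult_left_mono conductivity_nonneg)
  qed
  finally show ?thesis
    by (simp add: n_def mult_ac)
qed

text \<open>
  Gains are linear in the state-action frequencies \<open>stat x * pmf (\<pi> x) u\<close>. Mixing these frequencies, and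
  conditioning the mixture on the state, gives a policy for which the mixed state
  distribution \<open>\<rho>\<close> is stationary. The weights thus vary with the state. Mixing the policies
  with a constant weight would not make the gain linear.
\<close>

lemma mixed_policy:
  assumes \<theta>: "0 \<le> \<theta>" "\<theta> \<le> 1"
  shows "\<exists>\<pi>. \<forall>f. gain \<pi> f = (1 - \<theta>) * gain \<pi>0 f + \<theta> * gain \<pi>1 f"
proof -
  define \<rho> where "\<rho> x = (1 - \<theta>) * chain.stat \<pi>0 x + \<theta> * chain.stat \<pi>1 x" for x
  define w where "w x = \<theta> * chain.stat \<pi>1 x / \<rho> x" for x
  define \<pi> where "\<pi> x = bind_pmf (bernoulli_pmf (w x)) (\<lambda>b. if b then \<pi>1 x else \<pi>0 x)" for x
  have \<rho>_pos: "0 < \<rho> x" for x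
    unfolding \<rho>_def using \<theta> chain.stat_pos[of \<pi>0 x] chain.stat_pos[of \<pi>1 x]
    by (cases "\<theta> = 0") (auto intro!: add_nonneg_pos mult_pos_pos mult_nonneg_nonneg)
  have w: "0 \<le> w x" "w x \<le> 1" for x
    using \<theta> \<rho>_pos[of x] chain.stat_nonneg[of \<pi>0 x] chain.stat_nonneg[of \<pi>1 x]
    by (auto simp: w_def divide_le_eq) (simp add: \<rho>_def)
  have occupation: "\<rho> x * pmf (\<pi> x) u =
      (1 - \<theta>) * (chain.stat \<pi>0 x * pmf (\<pi>0 x) u) + \<theta> * (chain.stat \<pi>1 x * pmf (\<pi>1 x) u)" for x u
  proof -
    have "pmf (\<pi> x) u = w x * pmf (\<pi>1 x) u + (1 - w x) * pmf (\<pi>0 x) u"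
      using w[of x] by (simp add: \<pi>_def pmf_bind)
    moreover have "\<rho> x * w x = \<theta> * chain.stat \<pi>1 x"
      using \<rho>_pos[of x] by (simp add: w_def)
    moreover have "\<rho> x * (1 - w x) = (1 - \<theta>) * chain.stat \<pi>0 x"
      using \<open>\<rho> x * w x = \<theta> * chain.stat \<pi>1 x\<close> by (simp add: right_diff_distrib) (simp add: \<rho>_def)
    ultimately show ?thesis
      by (simp only: distrib_left mult.assoc[symmetric])
  qed
  have average: "(\<Sum>x\<in>UNIV. \<rho> x * (\<Sum>u\<in>UNIV. pmf (\<pi> x) u * F x u)) =
      (1 - \<theta>) * (\<Sum>x\<in>UNIV. chain.stat \<pi>0 x * (\<Sum>u\<in>UNIV. pmf (\<pi>0 x) u * F x u)) +
      \<theta> * (\<Sum>x\<in>UNIV. chain.stat \<pi>1 x * (\<Sum>u\<in>UNIV. pmf (\<pi>1 x) u * F x u))" for F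
  proof -
    have "(\<Sum>x\<in>UNIV. \<rho> x * (\<Sum>u\<in>UNIV. pmf (\<pi> x) u * F x u)) =
        (\<Sum>x\<in>UNIV. \<Sum>u\<in>UNIV. (\<rho> x * pmf (\<pi> x) u) * F x u)"
      by (simp add: sum_distrib_left mult.assoc)
    also have "\<dots> = (\<Sum>x\<in>UNIV. \<Sum>u\<in>UNIV. (1 - \<theta>) * (chain.stat \<pi>0 x * (pmf (\<pi>0 x) u * F x u)) +
        \<theta> * (chain.stat \<pi>1 x * (pmf (\<pi>1 x) u * F x u)))"
      by (simp only: occupation distrib_right mult.assoc)
    finally show ?thesis
      by (simp only: sum.distrib sum_distrib_left)
  qed
  have kernel: "(\<Sum>x\<in>UNIV. \<sigma> x * policy_kernel p \<pi>' x z) =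
      (\<Sum>x\<in>UNIV. \<sigma> x * (\<Sum>u\<in>UNIV. pmf (\<pi>' x) u * pmf (p x u) z))" for \<sigma> \<pi>' z
    by (simp add: policy_kernel_def)
  have "chain.stationary \<pi> \<rho>"
    unfolding chain.stationary_def
  proof (intro conjI allI)
    show "0 \<le> \<rho> x" for x
      using \<rho>_pos[of x] by simp
    show "(\<Sum>x\<in>UNIV. \<rho> x) = 1"
      unfolding \<rho>_def by (simp add: sum.distrib chain.sum_stat flip: sum_distrib_left)
    show "(\<Sum>x\<in>UNIV. \<rho> x * policy_kernel p \<pi> x z) = \<rho> z" for z
      unfolding kernel average unfolding kernel[symmetric]
      using chain.stationary_stat[of \<pi>0] chain.stationary_stat[of \<pi>1]
      by (simp add: chain.stationary_def \<rho>_def)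
  qed
  then have "chain.stat \<pi> = \<rho>"
    using chain.stationary_unique by metis
  then have "gain \<pi> f = (1 - \<theta>) * gain \<pi>0 f + \<theta> * gain \<pi>1 f" for f
    using average[of f] by (simp add: gain_def policy_payoff_def)
  then show ?thesis
    by blast
qed

lemma gain_bounds:
  assumes f: "\<And>x u. 0 \<le> f x u \<and> f x u \<le> 1"
  shows "0 \<le> gain \<pi> f" and "gain \<pi> f \<le> 1"
proof -
  show "0 \<le> gain \<pi> f"
    unfolding gain_def by (intro sum_nonneg mult_nonneg_nonneg policy_payoff_bounds f chain.stat_nonneg)
  have "gain \<pi> f \<le> (\<Sum>x\<in>UNIV. chain.stat \<pi> x)"
    unfolding gain_def by (intro sum_mono mult_left_le policy_payoff_bounds f chain.stat_nonneg)
  then show "gain \<pi> f \<le> 1"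
    by (simp add: chain.sum_stat)
qed

end

section \<open>Rounding to the tessellation\<close>

lemma finite_grid_policies:
  assumes "finite D"
  shows "finite (grid_policies D :: ('x::finite, 'u) policy set)"
proof -
  have "grid_policies D = (PiE UNIV (\<lambda>_. D) :: ('x, 'u) policy set)"
    by (auto simp: grid_policies_def PiE_def)
  then show ?thesis
    using assms by (simp add: finite_PiE)
qed

lemma tessellation_rounding:
  assumes "tessellation \<epsilon> D"
  obtains \<pi>' where "\<pi>' \<in> grid_policies D" and "\<And>x. l1_dist (\<pi> x) (\<pi>' x) \<le> \<epsilon>"
proof -
  have "\<forall>x. \<exists>d. d \<in> D \<and> l1_dist (\<pi> x) d \<le> \<epsilon>"
    using assms by (auto simp: tessellation_def)
  then obtain \<pi>' where "\<forall>x. \<pi>' x \<in> D \<and> l1_dist (\<pi> x) (\<pi>' x) \<le> \<epsilon>"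
    by metis
  then show ?thesis
    by (intro that[of \<pi>']) (auto simp: grid_policies_def)
qed

theorem lemma1:
  fixes p :: "('x::finite, 'u::finite) kernel"
    and \<mu> :: "'x pmf"
    and r c :: "'x \<Rightarrow> 'u \<Rightarrow> real"
    and cub :: real
    and \<pi>opt :: "('x, 'u) policy"
  assumes "2 \<le> CARD('x)"
    and "unichain p"
    and "\<And>x u. 0 \<le> r x u \<and> r x u \<le> 1"
    and "\<And>x u. 0 \<le> c x u \<and> c x u \<le> 1"
    and "strictly_feasible p \<mu> c cub"
    and "optimal_policy p \<mu> r c cub \<pi>opt"
  shows "(\<forall>\<epsilon> D \<pi>hat. 0 < \<epsilon> \<longrightarrow> tessellation \<epsilon> D \<longrightarrow> closest_policy D \<pi>opt \<pi>hat \<longrightarrow>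
            avg_reward p \<mu> r \<pi>hat
              \<ge> avg_reward p \<mu> r \<pi>opt - \<epsilon> * conductivity p * (real CARD('x))\<^sup>2 \<and>
            avg_cost p \<mu> c \<pi>hat \<le> cub + \<epsilon> * conductivity p * (real CARD('x))\<^sup>2)
       \<and> (\<exists>C \<epsilon>\<^sub>1. 0 < \<epsilon>\<^sub>1 \<and>
            (\<forall>\<epsilon> D. 0 < \<epsilon> \<longrightarrow> \<epsilon> < \<epsilon>\<^sub>1 \<longrightarrow> tessellation \<epsilon> D \<longrightarrow>
               feasible_grid p \<mu> c cub D \<noteq> {} \<and>
               \<bar>avg_reward p \<mu> r \<pi>opt
                 - (MAX \<pi>\<in>feasible_grid p \<mu> c cub D. avg_reward p \<mu> r \<pi>)\<bar> \<le> C * \<epsilon>))"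
proof -
  interpret unichain_mdp p
    by unfold_locales fact
  note avg = avg_reward_eq_gain avg_cost_eq_gain
  define L where "L = conductivity p * (real CARD('x))\<^sup>2"
  have L: "0 \<le> L"
    by (simp add: L_def conductivity_nonneg)
  have opt_cost: "gain \<pi>opt c \<le> cub"
    and opt: "\<And>\<pi>. gain \<pi> c \<le> cub \<Longrightarrow> gain \<pi> r \<le> gain \<pi>opt r"
    using assms(6) by (auto simp: optimal_policy_def avg)
  obtain \<pi>f \<epsilon>0 where \<epsilon>0: "0 < \<epsilon>0" and \<pi>f: "gain \<pi>f c < cub - \<epsilon>0"
    using assms(5) by (auto simp: strictly_feasible_def avg)
  have perturb: "\<bar>gain \<pi>' r - gain \<pi> r\<bar> \<le> L * \<epsilon>" "\<bar>gain \<pi>' c - gain \<pi> c\<bar> \<le> L * \<epsilon>"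
    if "\<And>x. l1_dist (\<pi> x) (\<pi>' x) \<le> \<epsilon>" for \<pi> \<pi>' :: "('x, 'u) policy" and \<epsilon>
    using gain_perturbation[of r \<pi> \<pi>' \<epsilon>] gain_perturbation[of c \<pi> \<pi>' \<epsilon>] that assms(1,3,4)
    by (simp_all add: L_def mult_ac)
  show ?thesis
  proof (intro conjI)
    show "\<forall>\<epsilon> D \<pi>hat. 0 < \<epsilon> \<longrightarrow> tessellation \<epsilon> D \<longrightarrow> closest_policy D \<pi>opt \<pi>hat \<longrightarrow>
        avg_reward p \<mu> r \<pi>hat \<ge> avg_reward p \<mu> r \<pi>opt - \<epsilon> * conductivity p * (real CARD('x))\<^sup>2 \<and>
        avg_cost p \<mu> c \<pi>hat \<le> cub + \<epsilon> * conductivity p * (real CARD('x))\<^sup>2"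
    proof (intro allI impI)
      fix \<epsilon> :: real and D :: "'u pmf set" and \<pi>hat :: "('x, 'u) policy"
      assume tess: "tessellation \<epsilon> D" and closest: "closest_policy D \<pi>opt \<pi>hat"
      have "l1_dist (\<pi>opt x) (\<pi>hat x) \<le> \<epsilon>" for x
      proof -
        obtain d where "d \<in> D" "l1_dist (\<pi>opt x) d \<le> \<epsilon>"
          using tess by (auto simp: tessellation_def)
        then show ?thesis
          using closest unfolding closest_policy_def by (meson order_trans)
      qed
      then have "\<bar>gain \<pi>hat r - gain \<pi>opt r\<bar> \<le> L * \<epsilon>" "\<bar>gain \<pi>hat c - gain \<pi>opt c\<bar> \<le> L * \<epsilon>"
        using perturb[of \<pi>opt \<pi>hat \<epsilon>] by blast+
      with opt_cost show "avg_reward p \<mu> r \<pi>hat \<ge> avg_reward p \<mu> r \<pi>opt - \<epsilon> * conductivity p * (real CARD('x))\<^sup>2 \<and>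
          avg_cost p \<mu> c \<pi>hat \<le> cub + \<epsilon> * conductivity p * (real CARD('x))\<^sup>2"
        by (auto simp: avg L_def mult_ac)
    qed
    show "\<exists>C \<epsilon>\<^sub>1. 0 < \<epsilon>\<^sub>1 \<and>
        (\<forall>\<epsilon> D. 0 < \<epsilon> \<longrightarrow> \<epsilon> < \<epsilon>\<^sub>1 \<longrightarrow> tessellation \<epsilon> D \<longrightarrow>
           feasible_grid p \<mu> c cub D \<noteq> {} \<and>
           \<bar>avg_reward p \<mu> r \<pi>opt
             - (MAX \<pi>\<in>feasible_grid p \<mu> c cub D. avg_reward p \<mu> r \<pi>)\<bar> \<le> C * \<epsilon>)"
    proof (intro exI conjI allI impI)
      (* This range of the mesh keeps the weight \<theta> chosen next at most 1. The summand 1 avoids a division by 0. *)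
      show "0 < \<epsilon>0 / (L + 1)"
        using \<epsilon>0 L by simp
      fix \<epsilon> :: real and D :: "'u pmf set"
      assume \<epsilon>: "0 < \<epsilon>" "\<epsilon> < \<epsilon>0 / (L + 1)" and tess: "tessellation \<epsilon> D"
      (* The weight at which the slack \<epsilon>0 of the feasible policy pays for the rounding error L * \<epsilon>. *)
      define \<theta> where "\<theta> = L * \<epsilon> / \<epsilon>0"
      have "L * \<epsilon> \<le> \<epsilon>0"
        using \<epsilon> L by (simp add: less_divide_eq algebra_simps)
      then have \<theta>: "0 \<le> \<theta>" "\<theta> \<le> 1"
        using \<epsilon> \<epsilon>0 L by (auto simp: \<theta>_def)
      obtain \<pi>mix where mix: "\<And>f. gain \<pi>mix f = (1 - \<theta>) * gain \<pi>opt f + \<theta> * gain \<pi>f f"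
        using mixed_policy[OF \<theta>] by blast
      obtain \<pi>' where grid: "\<pi>' \<in> grid_policies D" and "\<And>x. l1_dist (\<pi>mix x) (\<pi>' x) \<le> \<epsilon>"
        using tessellation_rounding[OF tess, of \<pi>mix] by blast
      then have close: "\<bar>gain \<pi>' r - gain \<pi>mix r\<bar> \<le> L * \<epsilon>" "\<bar>gain \<pi>' c - gain \<pi>mix c\<bar> \<le> L * \<epsilon>"
        using perturb[of \<pi>mix \<pi>' \<epsilon>] by blast+
      have "gain \<pi>mix c \<le> (1 - \<theta>) * cub + \<theta> * (cub - \<epsilon>0)"
        unfolding mix using \<theta> opt_cost \<pi>f by (intro add_mono mult_left_mono) auto
      also have "\<dots> = cub - \<theta> * \<epsilon>0"
        by (simp add: algebra_simps)
      also have "\<dots> = cub - L * \<epsilon>"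
        using \<epsilon>0 by (simp add: \<theta>_def)
      finally have feasible: "\<pi>' \<in> feasible_grid p \<mu> c cub D"
        using close(2) grid by (simp add: feasible_grid_def avg)
      have "gain \<pi>mix r = gain \<pi>opt r - \<theta> * (gain \<pi>opt r - gain \<pi>f r)"
        unfolding mix by (simp add: algebra_simps)
      moreover have "\<theta> * (gain \<pi>opt r - gain \<pi>f r) \<le> \<theta> * 1"
        using \<theta> gain_bounds[of r \<pi>opt] gain_bounds[of r \<pi>f] assms(3) by (intro mult_left_mono) auto
      ultimately have reward: "gain \<pi>opt r - (L / \<epsilon>0 + L) * \<epsilon> \<le> gain \<pi>' r"
        using close(1) by (simp add: \<theta>_def algebra_simps)
      have fin: "finite (feasible_grid p \<mu> c cub D)"
        using tess finite_grid_policies[of D]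
        by (auto simp: feasible_grid_def tessellation_def)
      show "feasible_grid p \<mu> c cub D \<noteq> {}"
        using feasible by blast
      have "(MAX \<pi>\<in>feasible_grid p \<mu> c cub D. avg_reward p \<mu> r \<pi>) \<le> gain \<pi>opt r"
        using feasible fin opt by (intro Max.boundedI) (auto simp: feasible_grid_def avg)
      moreover have "gain \<pi>' r \<le> (MAX \<pi>\<in>feasible_grid p \<mu> c cub D. avg_reward p \<mu> r \<pi>)"
        using feasible fin by (intro Max_ge) (auto simp: avg)
      ultimately show "\<bar>avg_reward p \<mu> r \<pi>opt
          - (MAX \<pi>\<in>feasible_grid p \<mu> c cub D. avg_reward p \<mu> r \<pi>)\<bar> \<le> (L / \<epsilon>0 + L) * \<epsilon>"
        using reward by (simp add: avg)
    qed
  qed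
qed

end
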